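(* There are subsets $E$ and $R$ of $\mathbb{C}$ with the following properties: \begin{enumerate} \item $E$ and $R$ are disjoint; \item each path component of $R$ is (the image of) an injective curve $\gamma\colon(0,\infty)\to\mathbb{C}$ connecting some point $e$ of $E$ to $\infty$, i.e., $\lim_{t\to 0}\gamma(t)=e$ and $\lim_{t\to\infty}\gamma(t)=\infty$; \item each point $e$ of $E$ is the endpoint of one or several of these curves in $R$ (that is, for each $e\in E$ there is at least one path component of $R$, parametrized by a curve $\gamma$ as in (2), with $\lim_{t\to 0}\gamma(t)=e$); \item the set $R=\bigcup_\gamma \gamma((0,\infty))$, the union being over all the curves $\gamma$ in (2), has Hausdorff dimension $1$; \item the set $E$ of endpoints has Hausdorff dimension $2$ and even full $2$-dimensional Lebesgue measure, i.e., the set $\mathbb{C}\setminus E$ has $2$-dimensional Lebesgue measure zero; \item $E\cup R=\mathbb{C}$. \end{enumerate}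
   Context: A curve $\gamma\colon J\to\mathbb{C}$ is a continuous map on an interval $J$; it is identified with its image set $\{\gamma(t)\colon t\in J\}$. The limit $\lim_{t\to\infty}\gamma(t)=\infty$ means $|\gamma(t)|\to\infty$. Hausdorff dimension is taken with respect to the Euclidean metric on $\mathbb{C}\cong\mathbb{R}^2$. *)

theory Defs
  imports "HOL-Analysis.Analysis"
begin

text \<open>
  The contribution \<open>(diam U)\<^sup>d\<close> of a set to a Hausdorff sum. The case \<open>d = 0\<close> is separate because
  \<open>0 powr 0 = 0\<close>, whereas the usual convention makes the \<open>0\<close>-dimensional Hausdorff measure the
  counting measure; the empty set always contributes \<open>0\<close>.
\<close>

definition diam_power :: "real \<Rightarrow> 'a::metric_space set \<Rightarrow> ennreal" where
  "diam_power d U =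
     (if U = {} then 0 else if d = 0 then 1 else ennreal (diameter U powr d))"

text \<open>
  Boundedness is required explicitly because \<^const>\<open>diameter\<close> is meaningless on unbounded sets.
  Finite covers are included, since members of the cover may be empty.
\<close>

definition hausdorff_premeasure :: "real \<Rightarrow> real \<Rightarrow> 'a::metric_space set \<Rightarrow> ennreal" where
  "hausdorff_premeasure d \<delta> A =
     (INF U \<in> {U :: nat \<Rightarrow> 'a set.
                 A \<subseteq> (\<Union>i. U i) \<and> (\<forall>i. bounded (U i) \<and> diameter (U i) \<le> \<delta>)}.
        \<Sum>i. diam_power d (U i))"

text \<open>
  The premeasure increases as \<open>\<delta>\<close> decreases, so the supremum is the limit for \<open>\<delta> \<rightarrow> 0\<close>.
\<close>

definition hausdorff_measure :: "real \<Rightarrow> 'a::metric_space set \<Rightarrow> ennreal" where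
  "hausdorff_measure d A = (SUP \<delta> \<in> {0<..}. hausdorff_premeasure d \<delta> A)"

definition hausdorff_dim :: "'a::metric_space set \<Rightarrow> ennreal" where
  "hausdorff_dim A = (INF d \<in> {d. 0 \<le> d \<and> hausdorff_measure d A = 0}. ennreal d)"

definition injective_curve_to_infinity :: "(real \<Rightarrow> complex) \<Rightarrow> complex \<Rightarrow> bool" where
  "injective_curve_to_infinity \<gamma> e \<longleftrightarrow>
     continuous_on {0<..} \<gamma> \<and> inj_on \<gamma> {0<..} \<and>
     (\<gamma> \<longlongrightarrow> e) (at_right 0) \<and> filterlim \<gamma> at_infinity at_top"

end

theory Submission
  imports Defs
begin

text \<open>
  The sets arise from the dynamics of an explicit continuous map \<open>phi\<close> of the closed right half-plane
  \<open>P\<close> into itself, a piecewise elementary relative of the hyperbolic sine. It maps each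
  half-strip \<open>\<bar>Im z - 2j\<bar> \<le> 1\<close> of \<open>P\<close> homeomorphically onto \<open>P\<close>, with an inverse branch \<open>psi j\<close> that contracts the taxicab
  distance by the factor \<open>3/4\<close>. The real and imaginary parts along an orbit satisfy
  \<open>x\<^bsub>n+1\<^esub> + overhang y\<^bsub>n+1\<^esub> = 4 x\<^sub>n\<close> with \<open>overhang y = max 0 (\<bar>y\<bar> - 8)\<close>. Hence \<open>x\<^sub>n / 4\<^sup>n\<close> decreases to a limit,
  the potential of the orbit. The set \<open>R\<close> consists of the points of positive potential,
  in \<open>P\<close> and in its mirror image, and \<open>E\<close> of the points of potential 0.

  Two orbits that visit the same sequence of strips (that have the same itinerary) have imaginary
  parts at distance at most 2 at all times, so the linear recursion shows that their real parts differ by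
  \<open>4\<^sup>n\<close> times the difference of the potentials, up to a bounded error. With the contraction this
  gives \<open>same_itinerary_taxi\<close>: a point is determined by its itinerary and potential, and depends
  continuously on the potential. Conversely, if an itinerary occurs at all, then it occurs with every
  potential \<open>t \<ge> 0\<close> (\<open>point_with_potential\<close>): push the orbit horizontally to the desired potential
  and shadow the result. So the points with a given itinerary form a curve, parametrized by
  the potential, that starts at a point of \<open>E\<close> and runs to infinity inside \<open>R\<close>. Since every point has
  an itinerary, every point of \<open>E\<close> is the beginning of such a curve.

  The edges of the strips are mapped into the imaginary axis, where the potential vanishes. Hence a
  connected subset of \<open>R\<close> meets no edge at any time and has a single
  itinerary (\<open>connected_same_itinerary\<close>), so that the path components of \<open>R\<close> are exactly the curves
  without their endpoints.

  As to the dimension, convergence of \<open>x\<^sub>n / 4\<^sup>n\<close> to a positive limit means that the overhang is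
  eventually small compared with the real part, so the orbits in \<open>R\<close> finally stay
  close to the real axis in relation to their size. There the inverse branches contract the imaginary direction by a factor of order
  \<open>exp (-x)\<close>, that is, by about \<open>exp (-p 4\<^sup>n)\<close> at time \<open>n\<close>, where \<open>p\<close> is the potential. Only about \<open>4\<^sup>n\<close> strips are
  available at that time, so transversally to the curves \<open>R\<close> has dimension 0
  (\<open>cylinder_thickness\<close>, \<open>hausdorff_null_escape_core\<close>), and \<open>R\<close> is a null set for every exponent
  greater than 1. It contains the positive real axis, so its dimension is 1. Being null for
  the exponent 2, it is Lebesgue negligible, and therefore its complement \<open>E\<close> has full measure and
  dimension 2.
\<close>

section \<open>The expanding map and its inverse branches\<close>

text \<open>
  The inverse branches below mix the two coordinates. They are strict contractions for the
  taxicab norm, which is equivalent to the Euclidean one.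
\<close>

definition taxi :: "complex \<Rightarrow> real" where
  "taxi z = \<bar>Re z\<bar> + \<bar>Im z\<bar>"

lemma taxi_nonneg: "0 \<le> taxi z"
  by (simp add: taxi_def)

lemma taxi_triangle: "taxi (u - w) \<le> taxi (u - v) + taxi (v - w)"
  by (simp add: taxi_def)

lemma norm_le_taxi: "norm z \<le> taxi z"
  by (simp add: taxi_def cmod_le)

lemma taxi_le_norm: "taxi z \<le> 2 * norm z"
  using abs_Re_le_cmod[of z] abs_Im_le_cmod[of z] by (simp add: taxi_def)

definition parity_sign :: "int \<Rightarrow> real" where
  "parity_sign j = (if even j then 1 else -1)"

lemma parity_sign_square [simp]: "parity_sign j * (parity_sign j * x) = x"
  and abs_parity_sign [simp]: "\<bar>parity_sign j\<bar> = 1"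
  by (auto simp: parity_sign_def)

text \<open>
  The piecewise linear wave of period 4 with slope 1 on \<open>[-1, 1]\<close>. On the strip around each even
  integer it is an affine coordinate, with orientation alternating from strip to strip; this is what
  makes the expanding map continuous across the common boundary of two strips.
\<close>

definition triangle_wave :: "real \<Rightarrow> real" where
  "triangle_wave y = 2 / pi * arcsin (sin (pi / 2 * y))"

lemma sin_shift_int: "sin (x + of_int j * pi) = parity_sign j * sin x"
proof (cases "even j")
  case True
  then obtain k where k: "j = 2 * k" by blast
  have "sin (x + of_int j * pi) = sin (x + of_int k * (2 * pi))"
    by (simp add: k algebra_simps)
  also have "\<dots> = sin x" using sin.plus_of_int[where ?'a = real, of _ k] by simp
  finally show ?thesis using True by (simp add: parity_sign_def)
next
  case False
  then obtain k where k: "j = 2 * k + 1" by (blast elim: oddE)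
  have "sin (x + of_int j * pi) = sin (x + pi + of_int k * (2 * pi))"
    by (simp add: k algebra_simps)
  also have "\<dots> = sin (x + pi)" using sin.plus_of_int[where ?'a = real, of _ k] by simp
  finally show ?thesis using False by (simp add: parity_sign_def)
qed

lemma triangle_wave_shift:
  assumes "\<bar>b\<bar> \<le> 1"
  shows "triangle_wave (2 * of_int j + b) = parity_sign j * b"
proof -
  have 1: "sin (pi / 2 * (2 * of_int j + b)) = parity_sign j * sin (pi / 2 * b)"
    using sin_shift_int[of "pi / 2 * b" j] by (simp add: algebra_simps)
  have 2: "arcsin (sin (pi / 2 * b)) = pi / 2 * b"
    using assms pi_gt_zero mult_left_mono[of b 1 "pi / 2"] mult_left_mono[of "-1" b "pi / 2"]
    by (intro arcsin_sin) (auto simp: abs_le_iff)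
  have 3: "arcsin (- sin (pi / 2 * b)) = - (pi / 2 * b)"
    using arcsin_minus[of "sin (pi / 2 * b)"] 2 by simp
  show ?thesis
    unfolding triangle_wave_def 1 using 2 3 pi_gt_zero
    by (cases "even j") (simp_all add: parity_sign_def field_simps)
qed

lemma floor_half_cell: "\<bar>y - 2 * of_int \<lfloor>(y + 1) / 2\<rfloor>\<bar> \<le> (1::real)"
proof -
  have "of_int \<lfloor>(y + 1) / 2\<rfloor> \<le> (y + 1) / 2" "(y + 1) / 2 < of_int \<lfloor>(y + 1) / 2\<rfloor> + 1"
    by linarith+
  then show ?thesis by (simp add: abs_le_iff field_simps)
qed

lemma nearest_even: "\<exists>j::int. \<bar>y - 2 * of_int j\<bar> \<le> (1::real)"
  using floor_half_cell by blast

lemma abs_triangle_wave: "\<bar>triangle_wave y\<bar> \<le> 1"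
proof -
  obtain j :: int where j: "\<bar>y - 2 * of_int j\<bar> \<le> 1" using nearest_even by blast
  show ?thesis
    using triangle_wave_shift[OF j, of j] j by (simp add: abs_mult)
qed

lemma continuous_triangle_wave: "continuous_on A triangle_wave"
  unfolding triangle_wave_def by (intro continuous_intros) auto

text \<open>
  An odd piecewise linear homeomorphism of \<open>[-1, 1]\<close>. It has the small slope \<open>\<epsilon>\<close> around 0 and
  slope 2 near the two ends, so that the middle half of the interval occupies only a
  tiny part of the image. The function \<open>unsqueeze\<close> is its inverse.
\<close>

definition squeeze :: "real \<Rightarrow> real \<Rightarrow> real" where
  "squeeze \<epsilon> t = max (2 * t - 1) (min (\<epsilon> * t) (2 * t + 1))"

definition unsqueeze :: "real \<Rightarrow> real \<Rightarrow> real" where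
  "unsqueeze \<epsilon> b = max ((b - 1) / 2) (min (b / \<epsilon>) ((b + 1) / 2))"

lemma abs_squeeze:
  assumes "0 < \<epsilon>" "\<epsilon> \<le> 1" "\<bar>t\<bar> \<le> 1" shows "\<bar>squeeze \<epsilon> t\<bar> \<le> 1"
proof -
  have "\<bar>\<epsilon> * t\<bar> \<le> 1" using assms by (simp add: abs_mult mult_le_one)
  then show ?thesis using assms by (auto simp: squeeze_def)
qed

lemma abs_unsqueeze:
  assumes "\<bar>b\<bar> \<le> 1" "0 < \<epsilon>" shows "\<bar>unsqueeze \<epsilon> b\<bar> \<le> 1"
proof (cases "b \<ge> 0")
  case True
  then have "0 \<le> b / \<epsilon>" using assms by simp
  moreover have "(b - 1) / 2 \<le> 0" "(b + 1) / 2 \<le> 1" "(b + 1) / 2 \<ge> 0"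
    using assms True by auto
  ultimately show ?thesis unfolding unsqueeze_def by linarith
next
  case False
  then have "b / \<epsilon> \<le> 0" using assms by (simp add: divide_nonpos_pos)
  moreover have "(b - 1) / 2 \<ge> -1" "(b - 1) / 2 \<le> 0" "(b + 1) / 2 \<ge> 0"
    using assms False by auto
  ultimately show ?thesis unfolding unsqueeze_def by linarith
qed

lemma unsqueeze_squeeze:
  assumes "0 < \<epsilon>" "\<epsilon> \<le> 1" "\<bar>t\<bar> \<le> 1" shows "unsqueeze \<epsilon> (squeeze \<epsilon> t) = t"
proof (cases "t \<ge> 0")
  case True
  have 1: "0 \<le> \<epsilon> * t" using True assms by simp
  have 2: "\<epsilon> * t \<le> t" using True assms mult_right_mono[of \<epsilon> 1 t] by simp
  have s: "squeeze \<epsilon> t = max (2 * t - 1) (\<epsilon> * t)" using 2 True by (auto simp: squeeze_def)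
  have "(max (2 * t - 1) (\<epsilon> * t) + 1) / 2 \<ge> t" by simp
  moreover have "max (2 * t - 1) (\<epsilon> * t) / \<epsilon> \<ge> t"
    using assms by (simp add: field_simps le_max_iff_disj)
  moreover have "max (2 * t - 1) (\<epsilon> * t) / \<epsilon> = t \<or> (max (2 * t - 1) (\<epsilon> * t) + 1) / 2 = t"
    using assms by (auto simp: max_def)
  moreover have "(max (2 * t - 1) (\<epsilon> * t) - 1) / 2 \<le> t" using 1 2 True assms by auto
  ultimately show ?thesis unfolding s unsqueeze_def by linarith
next
  case False
  have 1: "\<epsilon> * t \<le> 0" using False assms by (simp add: mult_nonneg_nonpos)
  have 2: "t \<le> \<epsilon> * t" using False assms mult_right_mono_neg[of \<epsilon> 1 t] by simp
  have s: "squeeze \<epsilon> t = min (\<epsilon> * t) (2 * t + 1)" using 2 False assms unfolding squeeze_def by linarith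
  define m where "m = min (\<epsilon> * t) (2 * t + 1)"
  have "m \<le> 2 * t + 1" by (simp add: m_def)
  then have a: "(m - 1) / 2 \<le> t" by simp
  have "m \<le> \<epsilon> * t" by (simp add: m_def)
  then have b: "m / \<epsilon> \<le> t" using assms by (simp add: field_simps)
  have c: "m / \<epsilon> = t \<or> (m - 1) / 2 = t" using assms by (auto simp: m_def min_def)
  have "2 * t \<le> \<epsilon> * t + 1" using 2 False by linarith
  then have d: "t \<le> (m + 1) / 2" by (simp add: m_def min_def)
  have "min (m / \<epsilon>) ((m + 1) / 2) = m / \<epsilon>" using order_trans[OF b d] by (rule min.absorb1)
  then show ?thesis unfolding s m_def[symmetric] unsqueeze_def
    using c max.absorb1[OF b] max.absorb2[OF a] by (metis max.commute)
qed

lemma squeeze_unsqueeze: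
  assumes "0 < \<epsilon>" "\<epsilon> \<le> 1" "\<bar>b\<bar> \<le> 1" shows "squeeze \<epsilon> (unsqueeze \<epsilon> b) = b"
proof (cases "b \<ge> 0")
  case True
  have 1: "b \<le> b / \<epsilon>" using True assms by (simp add: pos_le_divide_eq mult_left_le)
  have "(b - 1) / 2 \<le> b / \<epsilon>" "(b - 1) / 2 \<le> (b + 1) / 2" using True assms 1 by (auto simp: field_simps)
  then have u: "unsqueeze \<epsilon> b = min (b / \<epsilon>) ((b + 1) / 2)"
    by (simp add: unsqueeze_def)
  define t where "t = min (b / \<epsilon>) ((b + 1) / 2)"
  have t: "0 \<le> t" using True assms by (simp add: t_def)
  have "\<epsilon> * t \<le> \<epsilon> * (b / \<epsilon>)" using assms by (intro mult_left_mono) (auto simp: t_def)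
  then have "\<epsilon> * t \<le> b" using assms by simp
  moreover have "t \<le> (b + 1) / 2" unfolding t_def by (rule min.cobounded2)
  then have "2 * t - 1 \<le> b" by simp
  moreover have "t = b / \<epsilon> \<or> t = (b + 1) / 2" unfolding t_def min_def by (rule if_split[THEN iffD2]) blast
  then have "\<epsilon> * t = b \<or> 2 * t - 1 = b" using assms by auto
  moreover have "\<epsilon> * t \<le> t" using t assms mult_right_mono[of \<epsilon> 1 t] by simp
  ultimately show ?thesis unfolding u t_def[symmetric] squeeze_def using t by linarith
next
  case False
  have 1: "b / \<epsilon> \<le> b" using False assms mult_left_mono_neg[of \<epsilon> 1 b] by (simp add: pos_divide_le_eq)
  have "b \<le> (b + 1) / 2" using assms by simp
  then have "b / \<epsilon> \<le> (b + 1) / 2" using 1 by linarith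
  then have u: "unsqueeze \<epsilon> b = max ((b - 1) / 2) (b / \<epsilon>)"
    by (simp add: unsqueeze_def)
  define t where "t = max ((b - 1) / 2) (b / \<epsilon>)"
  have "b / \<epsilon> \<le> 0" using False assms by (simp add: divide_nonpos_pos)
  then have t: "t \<le> 0" using False assms by (simp add: t_def)
  have "\<epsilon> * (b / \<epsilon>) \<le> \<epsilon> * t" using assms by (intro mult_left_mono) (auto simp: t_def)
  then have "b \<le> \<epsilon> * t" using assms by simp
  moreover have "(b - 1) / 2 \<le> t" unfolding t_def by (rule max.cobounded1)
  then have "b \<le> 2 * t + 1" by simp
  moreover have "t = (b - 1) / 2 \<or> t = b / \<epsilon>" unfolding t_def max_def by (rule if_split[THEN iffD2]) blast
  then have "\<epsilon> * t = b \<or> 2 * t + 1 = b" using assms by auto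
  moreover have "t \<le> \<epsilon> * t" using t assms mult_right_mono_neg[of \<epsilon> 1 t] by simp
  ultimately show ?thesis unfolding u t_def[symmetric] squeeze_def using t by linarith
qed

lemma squeeze_diff:
  "\<bar>squeeze \<epsilon> t - squeeze \<epsilon>' t'\<bar> \<le> max (2 * \<bar>t - t'\<bar>) \<bar>\<epsilon> * t - \<epsilon>' * t'\<bar>"
proof -
  have *: "\<bar>max a b - max c d\<bar> \<le> max \<bar>a - c\<bar> \<bar>b - d\<bar>" "\<bar>min a b - min c d\<bar> \<le> max \<bar>a - c\<bar> \<bar>b - d\<bar>"
    for a b c d :: real by (auto simp: max_def min_def abs_if)
  have "\<bar>squeeze \<epsilon> t - squeeze \<epsilon>' t'\<bar> \<le>
      max \<bar>(2 * t - 1) - (2 * t' - 1)\<bar> (max \<bar>\<epsilon> * t - \<epsilon>' * t'\<bar> \<bar>(2 * t + 1) - (2 * t' + 1)\<bar>)"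
    unfolding squeeze_def by (rule order_trans[OF *(1)]) (intro max.mono order_refl *(2))
  also have "\<dots> = max (2 * \<bar>t - t'\<bar>) \<bar>\<epsilon> * t - \<epsilon>' * t'\<bar>"
    by (simp add: max_def abs_if)
  finally show ?thesis .
qed

lemma squeeze_middle:
  assumes "0 < \<epsilon>" "\<epsilon> \<le> 1" "\<bar>t\<bar> \<le> 1/2" shows "squeeze \<epsilon> t = \<epsilon> * t"
proof -
  have "\<bar>\<epsilon> * t\<bar> \<le> \<bar>t\<bar>"
    using assms mult_right_mono[of \<epsilon> 1 "\<bar>t\<bar>"] by (simp add: abs_mult)
  moreover have "t \<ge> 0 \<Longrightarrow> \<epsilon> * t \<ge> 0" "t \<le> 0 \<Longrightarrow> \<epsilon> * t \<le> 0"
    using assms by (auto simp: mult_nonneg_nonpos)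
  ultimately show ?thesis using assms(3) unfolding squeeze_def by linarith
qed

lemma unsqueeze_end:
  assumes "0 < \<epsilon>" "\<epsilon> \<le> 1" "\<bar>b\<bar> = 1" shows "\<bar>unsqueeze \<epsilon> b\<bar> = 1"
proof -
  have "1 / \<epsilon> \<ge> 1" using assms by simp
  then show ?thesis
    using assms(3) by (auto simp: unsqueeze_def abs_if split: if_splits)
qed

text \<open>
  The exponential decay of the slope is what forces dimension 1 in the end: an orbit that moves along
  a curve to infinity passes through the squeezed zone at every late time, with real part growing like
  \<open>4\<^sup>n\<close>, whereas there are only about \<open>4\<^sup>n\<close> strips to choose from at time \<open>n\<close>.
\<close>

definition slope :: "real \<Rightarrow> real" where
  "slope r = exp (- r) / 4"

lemma slope_pos: "0 < slope r" and slope_le: "r \<ge> 0 \<Longrightarrow> slope r \<le> 1 / 4"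
  by (auto simp: slope_def)

text \<open>
  The slope is its own derivative up to sign, so it is as flat as it is small. The decaying
  Lipschitz constant is needed for the thinning of strips, where the slopes at two levels are compared.
\<close>

lemma slope_diff:
  assumes "a \<le> r" "a \<le> r'"
  shows "\<bar>slope r - slope r'\<bar> \<le> exp (- a) / 4 * \<bar>r - r'\<bar>"
proof -
  have *: "\<bar>exp (- r) - exp (- r')\<bar> \<le> exp (- a) * \<bar>r - r'\<bar>"
    if "a \<le> r" "r \<le> r'" for r r' :: real
  proof -
    have "exp (- r) - exp (- r') = exp (- r) * (1 - exp (- (r' - r)))"
      by (simp add: exp_diff exp_minus field_simps exp_add)
    also have "\<dots> \<le> exp (- a) * (r' - r)"
    proof (rule mult_mono)
      show "1 - exp (- (r' - r)) \<le> r' - r"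
        using exp_ge_add_one_self[of "- (r' - r)"] by linarith
    qed (use that in auto)
    finally show ?thesis using that by simp
  qed
  have "\<bar>exp (- r) - exp (- r')\<bar> \<le> exp (- a) * \<bar>r - r'\<bar>"
    using *[of r r'] *[of r' r] assms by (cases "r \<le> r'") (auto simp: abs_minus_commute)
  then show ?thesis
    unfolding slope_def by (simp add: abs_divide flip: diff_divide_distrib)
qed

text \<open>
  The level curves of \<open>Re z + overhang (Im z)\<close> are wedges with a flat tip. They foliate the closed
  right half-plane \<open>P\<close>; the curve of level \<open>r \<ge> 0\<close> meets \<open>P\<close> in the points with \<open>\<bar>Im z\<bar> \<le> 8 + r\<close>, and
  ends on the imaginary axis at the heights \<open>8 + r\<close> and \<open>- (8 + r)\<close>. The width 8 of the flat tip is
  chosen large enough to make the inverse branches contract.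
\<close>

definition overhang :: "real \<Rightarrow> real" where
  "overhang y = max 0 (\<bar>y\<bar> - 8)"

lemma overhang_nonneg [simp]: "0 \<le> overhang y"
  by (simp add: overhang_def)

lemma overhang_diff: "\<bar>overhang y - overhang y'\<bar> \<le> \<bar>y - y'\<bar>"
  by (auto simp: overhang_def)

lemma abs_le_overhang: "\<bar>y\<bar> \<le> 8 + overhang y"
  by (auto simp: overhang_def)

text \<open>
  The map \<open>phi\<close> sends the vertical segment of a strip \<open>\<bar>Im z - 2j\<bar> \<le> 1\<close> at abscissa \<open>x\<close> onto the wedge of
  level \<open>r = 4x\<close>, so every half-strip is mapped homeomorphically onto \<open>P\<close>, with inverse \<open>psi j\<close>. The
  edges of the half-strip go to the imaginary axis.
\<close>

definition phi :: "complex \<Rightarrow> complex" where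
  "phi z = (let r = 4 * Re z; y = (8 + r) * unsqueeze (slope r) (triangle_wave (Im z))
            in Complex (r - overhang y) y)"

definition psi :: "int \<Rightarrow> complex \<Rightarrow> complex" where
  "psi j z = (let r = Re z + overhang (Im z)
     in Complex (r / 4) (2 * of_int j + parity_sign j * squeeze (slope r) (Im z / (8 + r))))"

lemma Re_phi: "Re (phi z) = 4 * Re z - overhang (Im (phi z))"
  by (simp add: phi_def Let_def)

lemma Im_phi:
  "Im (phi z) = (8 + 4 * Re z) * unsqueeze (slope (4 * Re z)) (triangle_wave (Im z))"
  by (simp add: phi_def Let_def)

lemma abs_Im_phi:
  assumes "0 \<le> Re z" shows "\<bar>Im (phi z)\<bar> \<le> 8 + 4 * Re z"
  using assms abs_unsqueeze[OF abs_triangle_wave[of "Im z"] slope_pos[of "4 * Re z"]]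
  by (simp add: Im_phi abs_mult mult_left_le)

lemma Re_phi_nonneg: "0 \<le> Re z \<Longrightarrow> 0 \<le> Re (phi z)"
  using abs_Im_phi[of z] by (auto simp: Re_phi overhang_def)

lemma funpow_phi_nonneg: "0 \<le> Re z \<Longrightarrow> 0 \<le> Re ((phi ^^ n) z)"
  by (induction n) (auto intro: Re_phi_nonneg)

lemma continuous_phi: "continuous_on A phi"
  unfolding phi_def Let_def unsqueeze_def overhang_def slope_def
  by (intro continuous_on_Complex continuous_intros
        continuous_on_compose2[OF continuous_triangle_wave]) auto

lemma continuous_funpow_phi: "continuous_on A (phi ^^ n)"
proof (induction n)
  case (Suc n)
  show ?case unfolding funpow.simps by (intro continuous_on_compose Suc continuous_phi)
qed simp

lemma fan_coordinate:
  assumes "0 \<le> Re z"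
  shows "\<bar>Im z / (8 + (Re z + overhang (Im z)))\<bar> \<le> 1"
proof -
  have "0 < 8 + (Re z + overhang (Im z))" "\<bar>Im z\<bar> \<le> 8 + (Re z + overhang (Im z))"
    using assms abs_le_overhang[of "Im z"] overhang_nonneg[of "Im z"] by linarith+
  then show ?thesis by (simp add: abs_divide)
qed

lemma Re_psi: "4 * Re (psi j z) = Re z + overhang (Im z)"
  by (simp add: psi_def Let_def)

lemma Re_psi_nonneg: "0 \<le> Re z \<Longrightarrow> 0 \<le> Re (psi j z)"
  using Re_psi[of j z] overhang_nonneg[of "Im z"] by linarith

lemma Im_psi:
  "Im (psi j z) = 2 * of_int j + parity_sign j *
     squeeze (slope (4 * Re (psi j z))) (Im z / (8 + 4 * Re (psi j z)))"
  unfolding Re_psi by (simp add: psi_def Let_def)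

lemma abs_squeeze_fan:
  assumes "0 \<le> Re z"
  shows "\<bar>squeeze (slope (4 * Re (psi j z))) (Im z / (8 + 4 * Re (psi j z)))\<bar> \<le> 1"
proof (rule abs_squeeze)
  show "\<bar>Im z / (8 + 4 * Re (psi j z))\<bar> \<le> 1"
    unfolding Re_psi using fan_coordinate[OF assms] by simp
  show "slope (4 * Re (psi j z)) \<le> 1"
    using slope_le[of "4 * Re (psi j z)"] Re_psi_nonneg[OF assms, of j] by linarith
qed (rule slope_pos)

lemma psi_strip: "0 \<le> Re z \<Longrightarrow> \<bar>Im (psi j z) - 2 * of_int j\<bar> \<le> 1"
  using abs_squeeze_fan[of z j] by (simp add: Im_psi[of j z] abs_mult)

text \<open>
  The level \<open>r\<close> of the point \<open>z\<close> is four times the real part of \<open>psi j z\<close>. At a fixed level both maps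
  are built from the inverse functions \<open>squeeze\<close> and \<open>unsqueeze\<close>.
\<close>

lemma phi_psi:
  assumes "0 \<le> Re z" shows "phi (psi j z) = z"
proof -
  define r where "r = 4 * Re (psi j z)"
  have r0: "0 \<le> r" and r: "r = Re z + overhang (Im z)"
    using Re_psi_nonneg[OF assms, of j] Re_psi[of j z] by (auto simp: r_def)
  have t: "\<bar>Im z / (8 + r)\<bar> \<le> 1" using fan_coordinate[OF assms] by (simp add: r)
  have s: "slope r \<le> 1" using slope_le[OF r0] by simp
  have "triangle_wave (Im (psi j z)) = squeeze (slope r) (Im z / (8 + r))"
    using triangle_wave_shift[of "parity_sign j * squeeze (slope r) (Im z / (8 + r))" j]
      abs_squeeze_fan[OF assms, of j]
    unfolding Im_psi[of j z] r_def[symmetric] by (simp add: abs_mult)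
  then have "Im (phi (psi j z)) = (8 + r) * (Im z / (8 + r))"
    unfolding Im_phi r_def[symmetric] using unsqueeze_squeeze[OF slope_pos s t] by simp
  then have I: "Im (phi (psi j z)) = Im z" using r0 by simp
  then show ?thesis
    using Re_phi[of "psi j z"] r by (intro complex_eqI) (auto simp: r_def)
qed

lemma psi_phi:
  assumes "0 \<le> Re z" "\<bar>Im z - 2 * of_int j\<bar> \<le> 1" shows "psi j (phi z) = z"
proof -
  define r where "r = 4 * Re z"
  have r0: "0 \<le> r" using assms by (simp add: r_def)
  have r: "4 * Re (psi j (phi z)) = r" by (simp add: Re_psi Re_phi r_def)
  have s: "slope r \<le> 1" using slope_le[OF r0] by simp
  have w: "triangle_wave (Im z) = parity_sign j * (Im z - 2 * of_int j)"
    using triangle_wave_shift[OF assms(2), of j] by simp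
  have "Im (phi z) / (8 + r) = unsqueeze (slope r) (triangle_wave (Im z))"
    using r0 by (simp add: Im_phi r_def[symmetric])
  then have "Im (psi j (phi z)) = 2 * of_int j + parity_sign j * triangle_wave (Im z)"
    unfolding Im_psi[of j "phi z"] r
    using squeeze_unsqueeze[OF slope_pos s abs_triangle_wave, of "Im z"] by simp
  then show ?thesis using r by (intro complex_eqI) (auto simp: w r_def)
qed

text \<open>
  The position \<open>y / (8 + r)\<close> on a wedge, as a function of the point: the flat tip bounds
  the denominator away from 0.
\<close>

lemma quotient_diff:
  fixes r r' y y' :: real
  assumes "0 \<le> r" "0 \<le> r'" "\<bar>y' / (8 + r')\<bar> \<le> 1"
  shows "\<bar>y / (8 + r) - y' / (8 + r')\<bar> \<le> (\<bar>y - y'\<bar> + \<bar>r - r'\<bar>) / 8"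
proof -
  define t where "t = y' / (8 + r')"
  have y': "y' = t * (8 + r')" using assms by (simp add: t_def)
  have "y / (8 + r) - t = ((y - y') + t * (r' - r)) / (8 + r)"
    using assms by (simp add: y' field_simps)
  also have "\<bar>\<dots>\<bar> = \<bar>(y - y') + t * (r' - r)\<bar> / (8 + r)"
    using assms by simp
  also have "\<dots> \<le> (\<bar>y - y'\<bar> + \<bar>r - r'\<bar>) / 8"
  proof (rule frac_le)
    have "\<bar>t * (r' - r)\<bar> \<le> \<bar>r - r'\<bar>"
      using assms(3) by (simp add: t_def[symmetric] abs_mult mult_left_le_one_le abs_minus_commute)
    then show "\<bar>(y - y') + t * (r' - r)\<bar> \<le> \<bar>y - y'\<bar> + \<bar>r - r'\<bar>" by linarith
  qed (use assms in auto)
  finally show ?thesis by (simp add: t_def)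
qed

lemma product_diff:
  fixes e e' t t' a :: real
  assumes "\<bar>e\<bar> \<le> a" "\<bar>t'\<bar> \<le> b"
  shows "\<bar>e * t - e' * t'\<bar> \<le> a * \<bar>t - t'\<bar> + b * \<bar>e - e'\<bar>"
proof -
  have "e * t - e' * t' = e * (t - t') + t' * (e - e')" by (simp add: algebra_simps)
  also have "\<bar>\<dots>\<bar> \<le> \<bar>e\<bar> * \<bar>t - t'\<bar> + \<bar>t'\<bar> * \<bar>e - e'\<bar>"
    by (metis abs_mult abs_triangle_ineq)
  also have "\<dots> \<le> a * \<bar>t - t'\<bar> + b * \<bar>e - e'\<bar>"
    using assms by (intro add_mono mult_right_mono) auto
  finally show ?thesis .
qed

text \<open>
  The real part of \<open>psi j z\<close> is a quarter of the level of \<open>z\<close>, which is 1-Lipschitz. The position on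
  the wedge is \<open>1/4\<close>-Lipschitz, and the squeezing, whose slope varies with the level, at most doubles this
  constant. The two parts add up to \<open>3/4\<close>.
\<close>

lemma psi_contraction:
  assumes "0 \<le> Re u" "0 \<le> Re v"
  shows "taxi (psi j u - psi j v) \<le> 3/4 * taxi (u - v)"
proof -
  define r r' where "r = 4 * Re (psi j u)" and "r' = 4 * Re (psi j v)"
  define t t' where "t = Im u / (8 + r)" and "t' = Im v / (8 + r')"
  define L where "L = taxi (u - v)"
  have r0: "0 \<le> r" "0 \<le> r'" using assms by (auto simp: r_def r'_def Re_psi_nonneg)
  have t1: "\<bar>t'\<bar> \<le> 1"
    unfolding t'_def r'_def Re_psi using fan_coordinate[OF assms(2)] by simp
  have rr: "\<bar>r - r'\<bar> \<le> L"
    using overhang_diff[of "Im u" "Im v"] by (simp add: r_def r'_def Re_psi L_def taxi_def)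
  have "\<bar>t - t'\<bar> \<le> (\<bar>Im u - Im v\<bar> + \<bar>r - r'\<bar>) / 8"
    unfolding t_def t'_def using r0 t1[unfolded t'_def] by (intro quotient_diff) auto
  moreover have "\<bar>Im u - Im v\<bar> \<le> L" by (simp add: L_def taxi_def)
  ultimately have tt: "\<bar>t - t'\<bar> \<le> L / 4" using rr by simp
  have ss: "\<bar>slope r - slope r'\<bar> \<le> L / 4"
    using slope_diff[of 0 r r'] r0 rr by simp
  have "\<bar>slope r * t - slope r' * t'\<bar> \<le> 1/4 * \<bar>t - t'\<bar> + 1 * \<bar>slope r - slope r'\<bar>"
    using slope_le[OF r0(1)] slope_pos[of r] t1 by (intro product_diff) auto
  then have "\<bar>slope r * t - slope r' * t'\<bar> \<le> L / 2" using tt ss taxi_nonneg[of "u - v"] by (simp add: L_def)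
  then have "\<bar>squeeze (slope r) t - squeeze (slope r') t'\<bar> \<le> L / 2"
    using squeeze_diff[of "slope r" t "slope r'" t'] tt by (auto simp: max_def split: if_splits)
  moreover have "Im (psi j u) - Im (psi j v) = parity_sign j * (squeeze (slope r) t - squeeze (slope r') t')"
    unfolding Im_psi[of j u] Im_psi[of j v] r_def[symmetric] r'_def[symmetric]
      t_def[symmetric] t'_def[symmetric]
    by (simp add: right_diff_distrib)
  then have "\<bar>Im (psi j u) - Im (psi j v)\<bar> = \<bar>squeeze (slope r) t - squeeze (slope r') t'\<bar>"
    by (simp add: abs_mult)
  moreover have "\<bar>Re (psi j u) - Re (psi j v)\<bar> \<le> L / 4"
    using rr unfolding r_def r'_def by linarith
  ultimately show ?thesis by (simp add: taxi_def L_def)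
qed

section \<open>Potential and itineraries\<close>

text \<open>
  Along an orbit \<open>x\<^sub>n + i y\<^sub>n\<close> the relation \<open>x\<^bsub>n+1\<^esub> = 4 x\<^sub>n - overhang y\<^bsub>n+1\<^esub>\<close> is linear in the real part, so
  \<open>x\<^sub>n / 4\<^sup>n\<close> decreases to \<open>x\<^sub>0 - (\<Sum>n\<ge>1. overhang y\<^sub>n / 4\<^sup>n)\<close>. This limit serves as a canonical parameter on
  each curve, with 0 at the endpoint.
\<close>

definition potential :: "complex \<Rightarrow> real" where
  "potential z = lim (\<lambda>n. Re ((phi ^^ n) z) / 4 ^ n)"

lemma decseq_scaled_orbit: "decseq (\<lambda>n. Re ((phi ^^ n) z) / 4 ^ n)"
  using overhang_nonneg
  by (intro decseq_SucI) (simp add: Re_phi field_simps)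

lemma potential_LIMSEQ:
  assumes "0 \<le> Re z" shows "(\<lambda>n. Re ((phi ^^ n) z) / 4 ^ n) \<longlonglongrightarrow> potential z"
proof -
  have "\<exists>L. (\<lambda>n. Re ((phi ^^ n) z) / 4 ^ n) \<longlonglongrightarrow> L"
    using decseq_convergent[OF decseq_scaled_orbit, where B = 0] funpow_phi_nonneg[OF assms]
    by (metis divide_nonneg_nonneg zero_le_power zero_le_numeral)
  then show ?thesis unfolding potential_def by (simp add: limI convergent_LIMSEQ_iff[symmetric] convergent_def)
qed

lemma potential_le:
  assumes "0 \<le> Re z" shows "4 ^ n * potential z \<le> Re ((phi ^^ n) z)"
  using decseq_ge[OF decseq_scaled_orbit potential_LIMSEQ[OF assms], of n]
  by (simp add: field_simps)

lemma potential_nonneg: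
  assumes "0 \<le> Re z" shows "0 \<le> potential z"
  using LIMSEQ_le_const[OF potential_LIMSEQ[OF assms]] funpow_phi_nonneg[OF assms]
  by simp

text \<open>
  A point whose orbit meets a common boundary of two strips has several itineraries; it will turn
  out to be the endpoint of a curve for each of them.
\<close>

definition has_itinerary :: "(nat \<Rightarrow> int) \<Rightarrow> complex \<Rightarrow> bool" where
  "has_itinerary s z \<longleftrightarrow> (\<forall>n. \<bar>Im ((phi ^^ n) z) - 2 * of_int (s n)\<bar> \<le> 1)"

lemma itinerary_exists: "\<exists>s. has_itinerary s z"
  unfolding has_itinerary_def by (rule choice) (intro allI nearest_even)

lemma same_itinerary_Im:
  assumes "has_itinerary s u" "has_itinerary s v"
  shows "\<bar>Im ((phi ^^ n) u) - Im ((phi ^^ n) v)\<bar> \<le> 2"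
proof -
  have "\<bar>Im ((phi ^^ n) u) - 2 * of_int (s n)\<bar> \<le> 1" "\<bar>Im ((phi ^^ n) v) - 2 * of_int (s n)\<bar> \<le> 1"
    using assms by (auto simp: has_itinerary_def)
  then show ?thesis by linarith
qed

text \<open>
  For two orbits in the same strips the imaginary parts differ by at most 2, so the difference \<open>D\<^sub>n\<close> of
  the real parts satisfies \<open>D\<^bsub>n+1\<^esub> \<ge> 4 D\<^sub>n - 2\<close>. A difference above the fixed point \<open>2/3\<close> of this
  recursion grows like \<open>4\<^sup>n\<close> and becomes visible in the potentials.
\<close>

lemma same_itinerary_Re:
  assumes "0 \<le> Re u" "0 \<le> Re v" "has_itinerary s u" "has_itinerary s v"
  shows "Re ((phi ^^ n) u) - Re ((phi ^^ n) v) \<le> 4 ^ n * (potential u - potential v) + 1"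
proof -
  define D where "D n = Re ((phi ^^ n) u) - Re ((phi ^^ n) v)" for n
  have step: "4 * D n - 2 \<le> D (Suc n)" for n
    using overhang_diff[of "Im ((phi ^^ Suc n) u)" "Im ((phi ^^ Suc n) v)"]
      same_itinerary_Im[OF assms(3,4), of "Suc n"]
    by (simp add: D_def Re_phi)
  have inc: "incseq (\<lambda>n. (D n - 2/3) / 4 ^ n)"
  proof (rule incseq_SucI)
    fix n
    have "(D n - 2/3) / 4 ^ n = (4 * D n - 2 - 2/3) / 4 ^ Suc n" by (simp add: field_simps)
    also have "\<dots> \<le> (D (Suc n) - 2/3) / 4 ^ Suc n"
      using step[of n] by (intro divide_right_mono) auto
    finally show "(D n - 2/3) / 4 ^ n \<le> (D (Suc n) - 2/3) / 4 ^ Suc n" .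
  qed
  have "(\<lambda>n. Re ((phi ^^ n) u) / 4 ^ n - Re ((phi ^^ n) v) / 4 ^ n - 2/3 * (1/4) ^ n)
      \<longlonglongrightarrow> potential u - potential v - 2/3 * 0"
    by (intro tendsto_intros potential_LIMSEQ assms LIMSEQ_power_zero) auto
  then have "(\<lambda>n. (D n - 2/3) / 4 ^ n) \<longlonglongrightarrow> potential u - potential v"
    by (simp add: D_def diff_divide_distrib power_divide)
  from incseq_le[OF inc this, of n] show ?thesis
    by (simp add: D_def field_simps)
qed

lemma taxi_le_orbit:
  assumes "0 \<le> Re u" "0 \<le> Re v" "has_itinerary s u" "has_itinerary s v"
  shows "taxi (u - v) \<le> (3/4) ^ n * taxi ((phi ^^ n) u - (phi ^^ n) v)"
proof (induction n)
  case (Suc n)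
  have "psi (s n) ((phi ^^ Suc n) w) = (phi ^^ n) w" if "0 \<le> Re w" "has_itinerary s w" for w
    using psi_phi[of "(phi ^^ n) w" "s n"] that funpow_phi_nonneg[of w n]
    by (simp add: has_itinerary_def)
  then have "psi (s n) ((phi ^^ Suc n) u) = (phi ^^ n) u" "psi (s n) ((phi ^^ Suc n) v) = (phi ^^ n) v"
    using assms by blast+
  then have *: "taxi ((phi ^^ n) u - (phi ^^ n) v) \<le> 3/4 * taxi ((phi ^^ Suc n) u - (phi ^^ Suc n) v)"
    using psi_contraction[OF funpow_phi_nonneg[OF assms(1)] funpow_phi_nonneg[OF assms(2)],
        of "s n" "Suc n" "Suc n"] by (simp only:)
  have "taxi (u - v) \<le> (3/4) ^ n * taxi ((phi ^^ n) u - (phi ^^ n) v)" by (rule Suc.IH)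
  also have "(3/4) ^ n * taxi ((phi ^^ n) u - (phi ^^ n) v)
      \<le> (3/4) ^ n * (3/4 * taxi ((phi ^^ Suc n) u - (phi ^^ Suc n) v))"
    using * by (rule mult_left_mono) simp
  also have "\<dots> = (3/4) ^ Suc n * taxi ((phi ^^ Suc n) u - (phi ^^ Suc n) v)" by simp
  finally show ?case .
qed simp

text \<open>
  After \<open>n\<close> steps the distance is at most \<open>4\<^sup>n\<close> times the difference of the potentials, plus 3, and \<open>n\<close>
  inverse branches contract this by \<open>(3/4)\<^sup>n\<close>. For equal potentials, \<open>n \<rightarrow> \<infinity>\<close> yields uniqueness; for nearby
  potentials, a fixed large \<open>n\<close> yields continuity.
\<close>

lemma same_itinerary_taxi:
  assumes "0 \<le> Re u" "0 \<le> Re v" "has_itinerary s u" "has_itinerary s v"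
  shows "taxi (u - v) \<le> 3 ^ n * \<bar>potential u - potential v\<bar> + 3 * (3/4) ^ n"
proof -
  define d where "d = potential u - potential v"
  have "Re ((phi ^^ n) u) - Re ((phi ^^ n) v) \<le> 4 ^ n * d + 1"
    "Re ((phi ^^ n) v) - Re ((phi ^^ n) u) \<le> 4 ^ n * (- d) + 1"
    using same_itinerary_Re[OF assms, of n] same_itinerary_Re[OF assms(2,1,4,3), of n]
    by (auto simp: d_def algebra_simps)
  moreover have "4 ^ n * d \<le> 4 ^ n * \<bar>d\<bar>" "4 ^ n * (- d) \<le> 4 ^ n * \<bar>d\<bar>"
    using mult_left_mono[of d "\<bar>d\<bar>" "4 ^ n"] mult_left_mono[of "- d" "\<bar>d\<bar>" "4 ^ n"] by auto
  ultimately have "\<bar>Re ((phi ^^ n) u) - Re ((phi ^^ n) v)\<bar> \<le> 4 ^ n * \<bar>d\<bar> + 1" by linarith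
  then have "taxi ((phi ^^ n) u - (phi ^^ n) v) \<le> 4 ^ n * \<bar>d\<bar> + 3"
    using same_itinerary_Im[OF assms(3,4), of n] by (simp add: taxi_def)
  then have "(3/4) ^ n * taxi ((phi ^^ n) u - (phi ^^ n) v) \<le> (3/4) ^ n * (4 ^ n * \<bar>d\<bar> + 3)"
    by (rule mult_left_mono) simp
  with taxi_le_orbit[OF assms, of n] have "taxi (u - v) \<le> (3/4) ^ n * (4 ^ n * \<bar>d\<bar> + 3)"
    by (rule order_trans)
  also have "\<dots> = ((3/4) ^ n * 4 ^ n) * \<bar>d\<bar> + 3 * (3/4) ^ n"
    by (simp only: distrib_left mult.assoc mult.commute[of _ 3])
  also have "(3/4 :: real) ^ n * 4 ^ n = 3 ^ n" by (simp flip: power_mult_distrib)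
  finally show ?thesis by (simp only: d_def)
qed

lemma same_itinerary_eq:
  assumes "0 \<le> Re u" "0 \<le> Re v" "has_itinerary s u" "has_itinerary s v"
    and "potential u = potential v"
  shows "u = v"
proof -
  have "(\<lambda>n. 3 * (3/4) ^ n) \<longlonglongrightarrow> 3 * (0::real)"
    by (intro tendsto_intros LIMSEQ_power_zero) auto
  moreover have bound: "taxi (u - v) \<le> 3 * (3/4) ^ n" for n
    using same_itinerary_taxi[OF assms(1-4), of n] unfolding assms(5) by simp
  then have "\<exists>N. \<forall>n\<ge>N. taxi (u - v) \<le> 3 * (3/4) ^ n" by (intro exI allI impI bound)
  ultimately have "taxi (u - v) \<le> 3 * 0" by (rule LIMSEQ_le_const)
  then have "norm (u - v) \<le> 0" using norm_le_taxi[of "u - v"] by linarith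
  then show ?thesis by simp
qed

text \<open>
  The composition \<open>psi (s m) \<circ> \<dots> \<circ> psi (s (m + k - 1))\<close>.
\<close>

fun pull :: "(nat \<Rightarrow> int) \<Rightarrow> nat \<Rightarrow> nat \<Rightarrow> complex \<Rightarrow> complex" where
  "pull s m 0 z = z"
| "pull s m (Suc k) z = psi (s m) (pull s (Suc m) k z)"

lemma Re_pull_nonneg: "0 \<le> Re z \<Longrightarrow> 0 \<le> Re (pull s m k z)"
  by (induction k arbitrary: m) (auto intro: Re_psi_nonneg)

lemma funpow_phi_pull:
  assumes "0 \<le> Re z" "n \<le> k" shows "(phi ^^ n) (pull s m k z) = pull s (m + n) (k - n) z"
  using assms(2)
proof (induction n arbitrary: k m)
  case (Suc n)
  then obtain k' where k: "k = Suc k'" "n \<le> k'" by (cases k) auto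
  have "(phi ^^ Suc n) (pull s m k z) = (phi ^^ n) (phi (psi (s m) (pull s (Suc m) k' z)))"
    by (simp add: k funpow_Suc_right del: funpow.simps)
  also have "\<dots> = (phi ^^ n) (pull s (Suc m) k' z)"
    by (simp add: phi_psi Re_pull_nonneg assms)
  finally show ?case using Suc.IH[OF k(2), of "Suc m"] by (simp add: k)
qed simp

text \<open>
  The orbit of \<open>w\<close> is translated horizontally by \<open>4\<^sup>n (t - potential w)\<close> at time \<open>n\<close>, which stays in
  the half-plane because the real part of the orbit is at least \<open>4\<^sup>n potential w\<close>. The translated points
  are not an orbit, but they have the correct real parts and lie in the correct strips, so each is within
  distance 2 of the inverse image of the next one. Contraction turns this pseudo-orbit into a true orbit
  within bounded distance, as in the shadowing lemma.
\<close>

lemma point_with_potential: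
  assumes w: "0 \<le> Re w" "has_itinerary s w" and t: "0 \<le> t"
  shows "\<exists>z. 0 \<le> Re z \<and> has_itinerary s z \<and> potential z = t"
proof -
  define W where
    "W n = Complex (Re ((phi ^^ n) w) + 4 ^ n * (t - potential w)) (Im ((phi ^^ n) w))" for n
  define A where "A k = pull s 0 k (W k)" for k
  have W0: "0 \<le> Re (W n)" for n
  proof -
    have "0 \<le> 4 ^ n * t" using t by simp
    then show ?thesis using potential_le[OF w(1), of n] by (simp add: W_def algebra_simps)
  qed
  \<comment> \<open>The linear recursion makes the real parts agree exactly; only the position in the strip is off.\<close>
  have near: "taxi (psi (s n) (W (Suc n)) - W n) \<le> 2" for n
  proof -
    have "4 * Re (psi (s n) (W (Suc n))) = 4 * Re (W n)"
      by (simp add: Re_psi W_def Re_phi algebra_simps)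
    moreover have "\<bar>Im (psi (s n) (W (Suc n))) - 2 * of_int (s n)\<bar> \<le> 1"
      using psi_strip[OF W0] .
    moreover have "\<bar>Im (W n) - 2 * of_int (s n)\<bar> \<le> 1"
      using w(2) by (simp add: W_def has_itinerary_def)
    ultimately show ?thesis by (simp add: taxi_def)
  qed
  \<comment> \<open>The constant 8 is the fixed point of the recursion \<open>b = 3/4 * b + 2\<close>.\<close>
  have bounded: "taxi (pull s m k (W (m + k)) - W m) \<le> 8" for m k
  proof (induction k arbitrary: m)
    case (Suc k)
    have "taxi (psi (s m) (pull s (Suc m) k (W (Suc m + k))) - psi (s m) (W (Suc m))) \<le> 3/4 * 8"
      using psi_contraction[of "pull s (Suc m) k (W (Suc m + k))" "W (Suc m)" "s m"] Suc.IH[of "Suc m"]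
      by (simp add: Re_pull_nonneg W0)
    then show ?case
      using near[of m] taxi_triangle[of "pull s m (Suc k) (W (m + Suc k))" "W m" "psi (s m) (W (Suc m))"]
      by simp
  qed (simp add: taxi_def)
  have step: "taxi (pull s m (Suc k) (W (Suc (m + k))) - pull s m k (W (m + k))) \<le> 2 * (3/4) ^ k" for m k
  proof (induction k arbitrary: m)
    case 0
    then show ?case using near[of m] by simp
  next
    case (Suc k)
    have "taxi (pull s m (Suc (Suc k)) (W (Suc (m + Suc k))) - pull s m (Suc k) (W (m + Suc k)))
       \<le> 3/4 * taxi (pull s (Suc m) (Suc k) (W (Suc (Suc m + k))) - pull s (Suc m) k (W (Suc m + k)))"
      using psi_contraction[of "pull s (Suc m) (Suc k) (W (Suc (Suc m + k)))" "pull s (Suc m) k (W (Suc m + k))" "s m"]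
        Re_pull_nonneg[of "W (Suc (Suc m + k))" s "Suc m" "Suc k"] Re_pull_nonneg[of "W (Suc m + k)" s "Suc m" k] W0
      by simp
    then show ?case using Suc.IH[of "Suc m"] by simp
  qed
  have "summable (\<lambda>k. A (Suc k) - A k)"
  proof (rule summable_comparison_test')
    show "summable (\<lambda>k. 2 * (3/4 :: real) ^ k)" by (intro summable_mult summable_geometric) simp
    show "norm (A (Suc k) - A k) \<le> 2 * (3/4) ^ k" for k
      using order_trans[OF norm_le_taxi step[of 0 k]] by (simp add: A_def)
  qed
  then have "convergent (\<lambda>n. A 0 + (\<Sum>k<n. A (Suc k) - A k))"
    by (intro convergent_add convergent_const) (simp add: summable_iff_convergent)
  then have "convergent A" by (simp only: sum_lessThan_telescope) simp
  then obtain z where z: "A \<longlonglongrightarrow> z" unfolding convergent_def by blast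
  have orbit: "(\<lambda>k. pull s n k (W (n + k))) \<longlonglongrightarrow> (phi ^^ n) z" for n
  proof -
    have "(\<lambda>k. (phi ^^ n) (A (k + n))) \<longlonglongrightarrow> (phi ^^ n) z"
      using continuous_funpow_phi[of UNIV n] LIMSEQ_ignore_initial_segment[OF z, of n]
      by (auto simp: continuous_on_eq_continuous_at intro: isCont_tendsto_compose)
    then show ?thesis by (simp add: A_def funpow_phi_pull W0 add.commute)
  qed
  have z0: "0 \<le> Re z"
    using LIMSEQ_le_const[OF tendsto_Re[OF z], of 0] Re_pull_nonneg[OF W0] by (auto simp: A_def)
  have "\<bar>Im ((phi ^^ n) z) - 2 * of_int (s n)\<bar> \<le> 1" for n
  proof (rule LIMSEQ_le_const2)
    show "(\<lambda>k. \<bar>Im (pull s n k (W (n + k))) - 2 * of_int (s n)\<bar>) \<longlonglongrightarrow> \<bar>Im ((phi ^^ n) z) - 2 * of_int (s n)\<bar>"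
      by (intro tendsto_intros orbit)
    have "\<bar>Im (pull s n k (W (n + k))) - 2 * of_int (s n)\<bar> \<le> 1" if "k \<ge> 1" for k
      using that psi_strip[OF Re_pull_nonneg[OF W0]] by (cases k) auto
    then show "\<exists>N. \<forall>k\<ge>N. \<bar>Im (pull s n k (W (n + k))) - 2 * of_int (s n)\<bar> \<le> 1" by blast
  qed
  then have s: "has_itinerary s z" by (simp add: has_itinerary_def)
  have close: "\<bar>Re ((phi ^^ n) z) - Re (W n)\<bar> \<le> 8" for n
  proof (rule LIMSEQ_le_const2)
    show "(\<lambda>k. \<bar>Re (pull s n k (W (n + k))) - Re (W n)\<bar>) \<longlonglongrightarrow> \<bar>Re ((phi ^^ n) z) - Re (W n)\<bar>"
      by (intro tendsto_intros orbit)
    have "\<bar>Re (pull s n k (W (n + k))) - Re (W n)\<bar> \<le> 8" for k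
      using bounded[of n k] by (simp add: taxi_def)
    then show "\<exists>N. \<forall>k\<ge>N. \<bar>Re (pull s n k (W (n + k))) - Re (W n)\<bar> \<le> 8" by blast
  qed
  have "(\<lambda>n. Re ((phi ^^ n) z) / 4 ^ n - Re (W n) / 4 ^ n) \<longlonglongrightarrow> 0"
  proof (rule Lim_null_comparison)
    have "\<bar>Re ((phi ^^ n) z) / 4 ^ n - Re (W n) / 4 ^ n\<bar> \<le> 8 / 4 ^ n" for n
      unfolding diff_divide_distrib[symmetric] abs_divide
      using close[of n] by (simp add: divide_right_mono)
    then show "\<forall>\<^sub>F n in sequentially. norm (Re ((phi ^^ n) z) / 4 ^ n - Re (W n) / 4 ^ n) \<le> 8 * (1/4) ^ n"
      by (simp add: power_divide)
    have "(\<lambda>n. 8 * (1/4 :: real) ^ n) \<longlonglongrightarrow> 8 * 0"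
      by (intro tendsto_intros LIMSEQ_power_zero) auto
    then show "(\<lambda>n. 8 * (1/4 :: real) ^ n) \<longlonglongrightarrow> 0" by simp
  qed
  moreover have "Re (W n) / 4 ^ n = Re ((phi ^^ n) w) / 4 ^ n + (t - potential w)" for n
    by (simp add: W_def add_divide_distrib)
  moreover have "(\<lambda>n. Re ((phi ^^ n) z) / 4 ^ n - (Re ((phi ^^ n) w) / 4 ^ n + (t - potential w)))
      \<longlonglongrightarrow> potential z - (potential w + (t - potential w))"
    by (intro tendsto_intros potential_LIMSEQ z0 w)
  ultimately have "0 = potential z - (potential w + (t - potential w))"
    by (intro LIMSEQ_unique) simp_all
  then show ?thesis using z0 s by auto
qed

section \<open>The curves and the path components\<close>

text \<open>
  The edges of the strips are mapped to the imaginary axis, and a point whose orbit meets the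
  imaginary axis has potential 0.
\<close>

lemma Im_orbit_off_boundary:
  assumes "0 \<le> Re z" "0 < potential z"
  shows "\<bar>Im ((phi ^^ n) z) - 2 * of_int j\<bar> \<noteq> 1"
proof
  define u where "u = (phi ^^ n) z"
  assume *: "\<bar>Im ((phi ^^ n) z) - 2 * of_int j\<bar> = 1"
  have u0: "0 \<le> Re u" unfolding u_def using assms(1) by (rule funpow_phi_nonneg)
  have "\<bar>triangle_wave (Im u)\<bar> = 1"
    using triangle_wave_shift[of "Im u - 2 * of_int j" j] * by (simp add: u_def abs_mult)
  then have "\<bar>unsqueeze (slope (4 * Re u)) (triangle_wave (Im u))\<bar> = 1"
    using slope_le[of "4 * Re u"] u0 by (intro unsqueeze_end slope_pos) auto
  then have "\<bar>Im (phi u)\<bar> = 8 + 4 * Re u" using u0 by (simp add: Im_phi abs_mult)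
  then have "Re (phi u) = 0" using u0 by (simp add: Re_phi overhang_def)
  moreover have "0 < 4 ^ Suc n * potential z" using assms(2) by simp
  ultimately show False using potential_le[OF assms(1), of "Suc n"] by (simp add: u_def)
qed

lemma connected_real_avoiding:
  fixes I :: "real set"
  assumes "connected I" "x \<in> I" "y \<in> I" "\<bar>x - c\<bar> \<le> 1" "\<And>z. z \<in> I \<Longrightarrow> \<bar>z - c\<bar> \<noteq> 1"
  shows "\<bar>y - c\<bar> \<le> 1"
proof (rule ccontr)
  assume y: "\<not> \<bar>y - c\<bar> \<le> 1"
  show False
  proof (cases "y > c")
    case True
    then have "c + 1 \<in> I"
      using connectedD_interval[OF assms(1-3), of "c + 1"] assms(4) y by auto
    then show False using assms(5)[of "c + 1"] by simp
  next
    case False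
    then have "c - 1 \<in> I"
      using connectedD_interval[OF assms(1) assms(3,2), of "c - 1"] assms(4) y by auto
    then show False using assms(5)[of "c - 1"] by simp
  qed
qed

text \<open>
  The orbit of a connected set of points of positive potential cannot cross from one strip into
  another, at any time.
\<close>

lemma connected_same_itinerary:
  assumes "connected C" "\<And>z. z \<in> C \<Longrightarrow> 0 \<le> Re z \<and> 0 < potential z"
    and "u \<in> C" "v \<in> C" "has_itinerary s u"
  shows "has_itinerary s v"
  unfolding has_itinerary_def
proof
  fix n
  have "connected ((\<lambda>z. Im ((phi ^^ n) z)) ` C)"
    by (intro connected_continuous_image continuous_intros continuous_funpow_phi assms)
  then show "\<bar>Im ((phi ^^ n) v) - 2 * of_int (s n)\<bar> \<le> 1"
    by (rule connected_real_avoiding[where x = "Im ((phi ^^ n) u)"])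
       (use assms Im_orbit_off_boundary in \<open>auto simp: has_itinerary_def\<close>)
qed

text \<open>
  Continuity at \<open>t\<close> comes from \<open>same_itinerary_taxi\<close>: first \<open>n\<close> is chosen to make \<open>3 (3/4)\<^sup>n\<close> small, then the
  neighbourhood of \<open>t\<close>.
\<close>

lemma hair_in_half_plane:
  assumes "0 \<le> Re w" "has_itinerary s w"
  obtains \<gamma> where "continuous_on {0..} \<gamma>"
    "\<And>t. 0 \<le> t \<Longrightarrow> 0 \<le> Re (\<gamma> t) \<and> has_itinerary s (\<gamma> t) \<and> potential (\<gamma> t) = t"
proof -
  have "\<forall>t. \<exists>z. 0 \<le> t \<longrightarrow> 0 \<le> Re z \<and> has_itinerary s z \<and> potential z = t"
    using point_with_potential[OF assms] by blast
  then obtain \<gamma> where \<gamma>: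
    "\<And>t. 0 \<le> t \<Longrightarrow> 0 \<le> Re (\<gamma> t) \<and> has_itinerary s (\<gamma> t) \<and> potential (\<gamma> t) = t"
    by metis
  have "continuous_on {0..} \<gamma>"
    unfolding continuous_on_iff
  proof safe
    fix t e :: real
    assume t: "0 \<le> t" and e: "0 < e"
    have "(\<lambda>n. 3 * (3/4) ^ n) \<longlonglongrightarrow> 3 * (0::real)"
      by (intro tendsto_intros LIMSEQ_power_zero) auto
    then have "\<forall>\<^sub>F n in sequentially. 3 * (3/4) ^ n < e / 2"
      by (rule order_tendstoD) (use e in simp)
    then obtain n where n: "3 * (3/4) ^ n < e / 2" by (auto simp: eventually_sequentially)
    show "\<exists>d>0. \<forall>t'\<in>{0..}. dist t' t < d \<longrightarrow> dist (\<gamma> t') (\<gamma> t) < e"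
    proof (intro exI[of _ "e / (2 * 3 ^ n)"] conjI ballI impI)
      show "0 < e / (2 * 3 ^ n)" using e by simp
      fix t' :: real
      assume t': "t' \<in> {0..}" and d: "dist t' t < e / (2 * 3 ^ n)"
      have "dist (\<gamma> t') (\<gamma> t) \<le> taxi (\<gamma> t' - \<gamma> t)"
        by (simp add: dist_norm norm_le_taxi)
      also have "\<dots> \<le> 3 ^ n * \<bar>potential (\<gamma> t') - potential (\<gamma> t)\<bar> + 3 * (3/4) ^ n"
        using \<gamma> t t' by (intro same_itinerary_taxi[of _ _ s]) auto
      also have "\<dots> = 3 ^ n * dist t' t + 3 * (3/4) ^ n"
        using \<gamma> t t' by (simp add: dist_real_def)
      also have "\<dots> < e / 2 + e / 2"
        using d n by (intro add_strict_mono) (auto simp: field_simps)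
      finally show "dist (\<gamma> t') (\<gamma> t) < e" by simp
    qed
  qed
  with \<gamma> show thesis using that by blast
qed

definition fold_plane :: "complex \<Rightarrow> complex" where
  "fold_plane z = Complex \<bar>Re z\<bar> (Im z)"

text \<open>
  The construction in the half-plane is reflected in the imaginary axis. All points of the axis have
  potential 0, so the two halves of the set of positive potential do not touch.
\<close>

definition ray_set :: "complex set" where
  "ray_set = {z. 0 < potential (fold_plane z)}"

lemma Re_fold [simp]: "Re (fold_plane z) = \<bar>Re z\<bar>"
  by (simp add: fold_plane_def)

lemma Re_nonzero_ray_set: "z \<in> ray_set \<Longrightarrow> Re z \<noteq> 0"
  using potential_le[of "fold_plane z" 0] by (auto simp: ray_set_def)

lemma continuous_fold: "continuous_on A fold_plane"
  unfolding fold_plane_def by (intro continuous_on_Complex continuous_intros)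

lemma connected_ray_set_same_side:
  assumes "connected C" "C \<subseteq> ray_set" "u \<in> C" "v \<in> C"
  shows "sgn (Re u) = sgn (Re v)"
proof (rule ccontr)
  assume *: "sgn (Re u) \<noteq> sgn (Re v)"
  have c: "connected (Re ` C)"
    by (intro connected_continuous_image continuous_intros assms)
  have "Re u \<noteq> 0" "Re v \<noteq> 0" using assms Re_nonzero_ray_set by auto
  with * have "Re u < 0 \<and> 0 < Re v \<or> Re v < 0 \<and> 0 < Re u"
    by (auto simp: sgn_if split: if_splits)
  then have "0 \<in> Re ` C"
    using connectedD_interval[OF c, of "Re u" "Re v" 0] connectedD_interval[OF c, of "Re v" "Re u" 0] assms
    by auto
  then show False using assms(2) Re_nonzero_ray_set by (metis imageE subsetD)
qed

text \<open>
  The curve of all points on the side \<open>\<sigma>\<close> that share the itinerary \<open>s\<close>. Its points are distinguished by their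
  potentials, and its part of positive potential is a whole path component because a
  connected subset of \<open>ray_set\<close> can neither leave a strip nor change sides.
\<close>

lemma landing_hair:
  assumes w: "has_itinerary s (fold_plane w)" and \<sigma>: "\<bar>\<sigma>\<bar> = 1" "Re w = \<sigma> * \<bar>Re w\<bar>"
  obtains c where
    "injective_curve_to_infinity c (c 0)" "c 0 \<notin> ray_set"
    "c ` {0<..} \<in> path_components_of (top_of_set ray_set)"
    "c (potential (fold_plane w)) = w"
proof -
  have w0: "0 \<le> Re (fold_plane w)" by simp
  obtain \<gamma> where cont: "continuous_on {0..} \<gamma>" and
    \<gamma>: "\<And>t. 0 \<le> t \<Longrightarrow> 0 \<le> Re (\<gamma> t) \<and> has_itinerary s (\<gamma> t) \<and> potential (\<gamma> t) = t"
    using hair_in_half_plane[OF w0 w] by blast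
  define c where "c t = Complex (\<sigma> * Re (\<gamma> t)) (Im (\<gamma> t))" for t
  have fold_c: "fold_plane (c t) = \<gamma> t" if "0 \<le> t" for t
    using \<gamma>[OF that] \<sigma>(1) by (simp add: fold_plane_def c_def abs_mult complex_eq_iff)
  have pot_c: "potential (fold_plane (c t)) = t" if "0 \<le> t" for t
    using \<gamma>[OF that] fold_c[OF that] by simp
  \<comment> \<open>A point is determined by its side, itinerary and potential.\<close>
  have recover: "c (potential (fold_plane v)) = v"
    if "has_itinerary s (fold_plane v)" "Re v = \<sigma> * \<bar>Re v\<bar>" for v
  proof -
    have v0: "0 \<le> Re (fold_plane v)" by simp
    have "\<gamma> (potential (fold_plane v)) = fold_plane v"
      using \<gamma>[OF potential_nonneg[OF v0]] that v0 by (intro same_itinerary_eq[of _ _ s]) auto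
    then show ?thesis using that(2) by (simp add: c_def complex_eq_iff fold_plane_def)
  qed
  have cont_c: "continuous_on {0..} c"
    unfolding c_def by (intro continuous_on_Complex continuous_intros cont)
  have "injective_curve_to_infinity c (c 0)"
    unfolding injective_curve_to_infinity_def
  proof (intro conjI)
    show "continuous_on {0<..} c" using cont_c by (rule continuous_on_subset) auto
    show "inj_on c {0<..}" using pot_c by (intro inj_on_inverseI[of _ "\<lambda>z. potential (fold_plane z)"]) auto
    show "(c \<longlongrightarrow> c 0) (at_right 0)"
      using cont_c by (auto simp: continuous_on intro: tendsto_within_subset)
    have "t \<le> norm (c t)" if "0 \<le> t" for t
    proof -
      have "t \<le> Re (\<gamma> t)" using potential_le[of "\<gamma> t" 0] \<gamma>[OF that] by simp
      also have "\<dots> \<le> \<bar>Re (c t)\<bar>" using \<sigma>(1) by (simp add: c_def abs_mult)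
      finally show ?thesis using abs_Re_le_cmod[of "c t"] by linarith
    qed
    then have "\<forall>\<^sub>F t in at_top. t \<le> norm (c t)"
      by (auto simp: eventually_at_top_linorder)
    then have "filterlim (\<lambda>t. norm (c t)) at_top at_top"
      by (rule filterlim_at_top_mono[OF filterlim_ident])
    then show "filterlim c at_infinity at_top"
      by (rule filterlim_norm_at_top_imp_at_infinity)
  qed
  moreover have "c 0 \<notin> ray_set" by (simp add: ray_set_def pot_c)
  moreover have "c ` {0<..} \<in> path_components_of (top_of_set ray_set)"
  proof -
    have in_R: "c ` {0<..} \<subseteq> ray_set" using pot_c by (auto simp: ray_set_def)
    then have "c 1 \<in> topspace (top_of_set ray_set)" by auto
    then obtain P where P: "P \<in> path_components_of (top_of_set ray_set)" "c 1 \<in> P"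
      using Union_path_components_of[of "top_of_set ray_set"] by blast
    have conn: "connected P" "P \<subseteq> ray_set"
      using path_connectedin_path_components_of[OF P(1)]
      by (auto simp: path_connectedin_subtopology path_connected_imp_connected)
    have "path_connected (c ` {0<..})"
      by (intro path_connected_continuous_image continuous_on_subset[OF cont_c]
          convex_imp_path_connected) auto
    then have "path_connectedin (top_of_set ray_set) (c ` {0<..})"
      using in_R by (simp add: path_connectedin_subtopology)
    then have "c ` {0<..} \<subseteq> P"
      using P by (intro path_components_of_maximal[OF P(1)]) (auto simp: disjnt_iff)
    moreover have "v \<in> c ` {0<..}" if v: "v \<in> P" for v
    proof -
      have "0 < potential (fold_plane v)" using v conn(2) by (auto simp: ray_set_def)
      moreover have "has_itinerary s (fold_plane v)"
      proof (rule connected_same_itinerary)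
        show "connected (fold_plane ` P)"
          by (intro connected_continuous_image continuous_fold conn)
        show "has_itinerary s (fold_plane (c 1))" using \<gamma>[of 1] fold_c[of 1] by simp
      qed (use P v conn in \<open>auto simp: ray_set_def\<close>)
      moreover have "Re v = \<sigma> * \<bar>Re v\<bar>"
      proof -
        have "Re (c 1) = \<sigma> * \<bar>Re (c 1)\<bar>" using \<gamma>[of 1] \<sigma>(1) by (simp add: c_def abs_mult)
        moreover have "Re (c 1) \<noteq> 0" using P conn Re_nonzero_ray_set by blast
        moreover have "sgn (Re v) = sgn (Re (c 1))"
          using connected_ray_set_same_side[OF conn v P(2)] .
        ultimately have "sgn (Re v) = \<sigma>"
          by (metis abs_mult_sgn mult.commute mult_right_cancel abs_eq_0)
        then show ?thesis by (metis abs_mult_sgn mult.commute)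
      qed
      ultimately show ?thesis using recover[of v] by (metis greaterThan_iff imageI)
    qed
    ultimately have "P = c ` {0<..}" by blast
    then show ?thesis using P by simp
  qed
  moreover have "c (potential (fold_plane w)) = w" using recover w \<sigma>(2) by blast
  ultimately show thesis by (rule that)
qed

text \<open>
  A point of potential 0 is the endpoint of this curve, and any other point lies on it.
\<close>

lemma hair_through_point:
  obtains c where
    "injective_curve_to_infinity c (c 0)" "c 0 \<in> - ray_set"
    "c ` {0<..} \<in> path_components_of (top_of_set ray_set)"
    "c (potential (fold_plane w)) = w"
proof -
  obtain s where s: "has_itinerary s (fold_plane w)" using itinerary_exists by blast
  show thesis
    by (rule landing_hair[OF s, of "if 0 \<le> Re w then 1 else -1"]) (use that in auto)
qed

lemma ray_set_structure:
  defines "E \<equiv> - ray_set" and "R \<equiv> ray_set"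
  shows "\<forall>C \<in> path_components_of (top_of_set R).
        \<exists>\<gamma>. \<exists>e \<in> E. injective_curve_to_infinity \<gamma> e \<and> C = \<gamma> ` {0<..}"
    and "\<forall>e \<in> E. \<exists>C \<in> path_components_of (top_of_set R).
        \<exists>\<gamma>. injective_curve_to_infinity \<gamma> e \<and> C = \<gamma> ` {0<..}"
    and "R = \<Union> {\<gamma> ` {0<..} | \<gamma>. \<exists>e \<in> E. injective_curve_to_infinity \<gamma> e \<and>
               \<gamma> ` {0<..} \<in> path_components_of (top_of_set R)}"
proof -
  have comp: "\<exists>\<gamma>. \<exists>e \<in> E. injective_curve_to_infinity \<gamma> e \<and> C = \<gamma> ` {0<..}"
    if C: "C \<in> path_components_of (top_of_set R)" for C
  proof -
    obtain w where w: "w \<in> C" using nonempty_path_components_of[OF C] by blast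
    then have wR: "w \<in> R" using path_components_of_subset[OF C] by auto
    obtain c where c: "injective_curve_to_infinity c (c 0)" "c 0 \<in> E"
      "c ` {0<..} \<in> path_components_of (top_of_set R)" "c (potential (fold_plane w)) = w"
      unfolding E_def R_def using hair_through_point[of w] by blast
    have "0 < potential (fold_plane w)" using wR by (simp add: R_def ray_set_def)
    then have "w \<in> c ` {0<..}" using c(4) by (metis greaterThan_iff imageI)
    then have "C = c ` {0<..}"
      using path_components_of_overlap[OF C c(3)] w by blast
    then show ?thesis using c by blast
  qed
  then show "\<forall>C \<in> path_components_of (top_of_set R).
        \<exists>\<gamma>. \<exists>e \<in> E. injective_curve_to_infinity \<gamma> e \<and> C = \<gamma> ` {0<..}" by blast
  show "\<forall>e \<in> E. \<exists>C \<in> path_components_of (top_of_set R).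
        \<exists>\<gamma>. injective_curve_to_infinity \<gamma> e \<and> C = \<gamma> ` {0<..}"
  proof
    fix e assume e: "e \<in> E"
    obtain c where c: "injective_curve_to_infinity c (c 0)"
      "c ` {0<..} \<in> path_components_of (top_of_set R)" "c (potential (fold_plane e)) = e"
      unfolding E_def R_def using hair_through_point[of e] by blast
    have "potential (fold_plane e) = 0"
      using e potential_nonneg[of "fold_plane e"] by (simp add: E_def ray_set_def)
    then show "\<exists>C \<in> path_components_of (top_of_set R).
        \<exists>\<gamma>. injective_curve_to_infinity \<gamma> e \<and> C = \<gamma> ` {0<..}" using c by auto
  qed
  show "R = \<Union> {\<gamma> ` {0<..} | \<gamma>. \<exists>e \<in> E. injective_curve_to_infinity \<gamma> e \<and>
               \<gamma> ` {0<..} \<in> path_components_of (top_of_set R)}" (is "R = \<Union> ?H")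
  proof
    have "R = \<Union> (path_components_of (top_of_set R))" by (simp add: Union_path_components_of)
    also have "\<dots> \<subseteq> \<Union> ?H" using comp by blast
    finally show "R \<subseteq> \<Union> ?H" .
    show "\<Union> ?H \<subseteq> R" using path_components_of_subset by fastforce
  qed
qed

section \<open>Hausdorff null sets and Hausdorff dimension\<close>

text \<open>
  For \<open>d > 0\<close> this is the vanishing of the \<open>d\<close>-dimensional Hausdorff measure. A small sum
  forces all diameters to be small, which takes the place of the bound on the mesh.
\<close>

definition hausdorff_null :: "real \<Rightarrow> 'a::metric_space set \<Rightarrow> bool" where
  "hausdorff_null d A \<longleftrightarrow> (\<forall>\<epsilon>>0. \<exists>U :: nat \<Rightarrow> 'a set.
     A \<subseteq> (\<Union>i. U i) \<and> (\<forall>i. bounded (U i)) \<and> (\<Sum>i. diam_power d (U i)) \<le> ennreal \<epsilon>)"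

lemma diam_power_pos: "0 < d \<Longrightarrow> diam_power d U = ennreal (diameter U powr d)"
  by (simp add: diam_power_def)

lemma hausdorff_nullE:
  assumes "hausdorff_null d A" "0 < \<epsilon>"
  obtains U :: "nat \<Rightarrow> 'a::metric_space set" where
    "A \<subseteq> (\<Union>i. U i)" "\<And>i. bounded (U i)" "(\<Sum>i. diam_power d (U i)) \<le> ennreal \<epsilon>"
  using assms unfolding hausdorff_null_def by blast

lemma hausdorff_null_mono: "hausdorff_null d B \<Longrightarrow> A \<subseteq> B \<Longrightarrow> hausdorff_null d A"
  unfolding hausdorff_null_def by (meson subset_trans)

lemma term_le_suminf: "f i \<le> (\<Sum>i. f i :: ennreal)"
  using sum_le_suminf[OF summableI, of "{i}" f] by simp

lemma hausdorff_measure_null: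
  assumes "hausdorff_null d A" "0 < d"
  shows "hausdorff_measure d A = 0"
proof -
  have "hausdorff_premeasure d \<delta> A \<le> 0" if \<delta>: "0 < \<delta>" for \<delta>
  proof (rule ennreal_le_epsilon)
    fix e :: real assume e: "0 < e"
    define e' where "e' = min e (\<delta> powr d)"
    have "0 < e'" using e \<delta> by (simp add: e'_def)
    from hausdorff_nullE[OF assms(1) this] obtain U :: "nat \<Rightarrow> 'a set" where
      U: "A \<subseteq> (\<Union>i. U i)" "\<And>i. bounded (U i)" "(\<Sum>i. diam_power d (U i)) \<le> ennreal e'"
      by metis
    have "diameter (U i) \<le> \<delta>" for i
    proof (rule ccontr)
      assume "\<not> diameter (U i) \<le> \<delta>"
      then have "\<delta> powr d < diameter (U i) powr d" using \<delta> assms(2) by (intro powr_less_mono2) auto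
      moreover have "ennreal (diameter (U i) powr d) \<le> ennreal e'"
        using order_trans[OF term_le_suminf[of "\<lambda>i. diam_power d (U i)" i] U(3)] assms(2)
        by (simp add: diam_power_pos)
      ultimately show False using \<open>0 < e'\<close> by (simp add: e'_def ennreal_le_iff)
    qed
    then have "hausdorff_premeasure d \<delta> A \<le> (\<Sum>i. diam_power d (U i))"
      unfolding hausdorff_premeasure_def using U by (intro INF_lower) auto
    also have "\<dots> \<le> ennreal e" using U(3) by (rule order_trans) (simp add: e'_def ennreal_leI)
    finally show "hausdorff_premeasure d \<delta> A \<le> 0 + ennreal e" by simp
  qed
  then show ?thesis unfolding hausdorff_measure_def by (simp add: SUP_eq_const)
qed

text \<open>
  Covers by sets of diameter at most 1 have smaller sums for the larger exponent. The bound on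
  the mesh is essential here, and \<open>d = 0\<close> is included because nonempty sets then contribute 1.
\<close>

lemma hausdorff_null_of_measure:
  assumes "hausdorff_measure d A = 0" "0 \<le> d" "d \<le> D" "0 < D"
  shows "hausdorff_null D A"
  unfolding hausdorff_null_def
proof (intro allI impI)
  fix \<epsilon> :: real assume \<epsilon>: "0 < \<epsilon>"
  have "hausdorff_premeasure d 1 A \<le> hausdorff_measure d A"
    unfolding hausdorff_measure_def by (rule SUP_upper) simp
  then have "hausdorff_premeasure d 1 A < ennreal \<epsilon>" using assms \<epsilon> by simp
  then obtain U :: "nat \<Rightarrow> 'a set" where
    U: "A \<subseteq> (\<Union>i. U i)" "\<And>i. bounded (U i)" "\<And>i. diameter (U i) \<le> 1"
      "(\<Sum>i. diam_power d (U i)) < ennreal \<epsilon>"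
    unfolding hausdorff_premeasure_def INF_less_iff by auto
  have "diam_power D (U i) \<le> diam_power d (U i)" for i
    using U(2,3)[of i] assms diameter_ge_0[OF U(2), of i]
    by (auto simp: diam_power_def intro!: ennreal_leI powr_mono' powr_le1)
  then have "(\<Sum>i. diam_power D (U i)) \<le> (\<Sum>i. diam_power d (U i))"
    by (intro suminf_le summableI)
  then show "\<exists>U :: nat \<Rightarrow> 'a set. A \<subseteq> (\<Union>i. U i) \<and> (\<forall>i. bounded (U i)) \<and>
      (\<Sum>i. diam_power D (U i)) \<le> ennreal \<epsilon>"
    using U by (meson less_imp_le order_trans)
qed

text \<open>
  A set that is not null for the exponent \<open>D\<close> itself is not null for any smaller one either.
\<close>

lemma hausdorff_dim_eqI:
  assumes "0 < D" "\<not> hausdorff_null D A" "\<And>d. D < d \<Longrightarrow> hausdorff_null d A"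
  shows "hausdorff_dim A = ennreal D"
proof (rule antisym)
  show "hausdorff_dim A \<le> ennreal D"
  proof (rule ennreal_le_epsilon)
    fix e :: real assume e: "0 < e"
    then have "hausdorff_measure (D + e) A = 0"
      using assms by (intro hausdorff_measure_null) auto
    then have "hausdorff_dim A \<le> ennreal (D + e)"
      unfolding hausdorff_dim_def using assms e by (intro INF_lower) auto
    then show "hausdorff_dim A \<le> ennreal D + ennreal e" using assms e by (simp add: ennreal_plus)
  qed
  show "ennreal D \<le> hausdorff_dim A"
    unfolding hausdorff_dim_def
  proof (rule INF_greatest)
    fix d assume "d \<in> {d. 0 \<le> d \<and> hausdorff_measure d A = 0}"
    then have "\<not> d \<le> D" using hausdorff_null_of_measure[of d A D] assms by auto
    then show "ennreal D \<le> ennreal d" by (simp add: ennreal_leI)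
  qed
qed

lemma hausdorff_null_UN_nat:
  fixes A :: "nat \<Rightarrow> 'a::metric_space set"
  assumes "\<And>i. hausdorff_null d (A i)"
  shows "hausdorff_null d (\<Union>i. A i)"
  unfolding hausdorff_null_def
proof (intro allI impI)
  fix \<epsilon> :: real assume \<epsilon>: "0 < \<epsilon>"
  have "\<exists>U :: nat \<Rightarrow> 'a set. A i \<subseteq> (\<Union>j. U j) \<and> (\<forall>j. bounded (U j)) \<and>
      (\<Sum>j. diam_power d (U j)) \<le> ennreal (\<epsilon> * (1/2) ^ Suc i)" for i
    using assms[of i] \<epsilon> unfolding hausdorff_null_def by simp
  then obtain U :: "nat \<Rightarrow> nat \<Rightarrow> 'a set" where
    U: "\<And>i. A i \<subseteq> (\<Union>j. U i j)" "\<And>i j. bounded (U i j)"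
      "\<And>i. (\<Sum>j. diam_power d (U i j)) \<le> ennreal (\<epsilon> * (1/2) ^ Suc i)"
    by metis
  define V where "V n = (case prod_decode n of (i, j) \<Rightarrow> U i j)" for n
  have "(\<Sum>n. diam_power d (V n)) = (\<Sum>i. \<Sum>j. diam_power d (U i j))"
    using suminf_ennreal_2dimen[of "\<lambda>i. \<Sum>j. diam_power d (U i j)" "\<lambda>(i, j). diam_power d (U i j)"]
    by (simp add: V_def case_prod_unfold)
  also have "\<dots> \<le> (\<Sum>i. ennreal (\<epsilon> * (1/2) ^ Suc i))"
    by (intro suminf_le summableI U)
  also have "\<dots> = ennreal \<epsilon>"
  proof (rule suminf_ennreal_eq)
    have "(\<lambda>i. \<epsilon> * (1/2) ^ Suc i) sums (\<epsilon> * 1)"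
      by (intro sums_mult power_half_series)
    then show "(\<lambda>i. \<epsilon> * (1/2) ^ Suc i) sums \<epsilon>" by simp
  qed (use \<epsilon> in auto)
  finally have "(\<Sum>n. diam_power d (V n)) \<le> ennreal \<epsilon>" .
  moreover have "(\<Union>i. A i) \<subseteq> (\<Union>n. V n)"
  proof safe
    fix x i assume "x \<in> A i"
    then obtain j where "x \<in> U i j" using U(1)[of i] by blast
    then have "x \<in> V (prod_encode (i, j))" by (simp add: V_def)
    then show "x \<in> (\<Union>n. V n)" by blast
  qed
  moreover have "bounded (V n)" for n by (simp add: V_def U case_prod_unfold)
  ultimately show "\<exists>V :: nat \<Rightarrow> 'a set. (\<Union>i. A i) \<subseteq> (\<Union>n. V n) \<and> (\<forall>n. bounded (V n)) \<and>
      (\<Sum>n. diam_power d (V n)) \<le> ennreal \<epsilon>" by blast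
qed

lemma hausdorff_null_UN:
  assumes "countable I" "\<And>i. i \<in> I \<Longrightarrow> hausdorff_null d (A i)"
  shows "hausdorff_null d (\<Union>i\<in>I. A i)"
proof (cases "I = {}")
  case True
  have "hausdorff_null d {}"
    unfolding hausdorff_null_def by (auto intro!: exI[of _ "\<lambda>_. {}"] simp: diam_power_def)
  then show ?thesis using True by simp
next
  case False
  have "(\<Union>i\<in>I. A i) = (\<Union>n. A (from_nat_into I n))"
    using range_from_nat_into[OF False assms(1)] by (metis image_image)
  then show ?thesis
    using assms(2) from_nat_into[OF False] by (simp add: hausdorff_null_UN_nat)
qed

lemma hausdorff_null_lipschitz_image:
  fixes f :: "'a::metric_space \<Rightarrow> 'b::real_normed_vector"
  assumes "hausdorff_null d A" "0 < d" "0 < L"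
    and "\<And>x y. x \<in> A \<Longrightarrow> y \<in> A \<Longrightarrow> dist (f x) (f y) \<le> L * dist x y"
  shows "hausdorff_null d (f ` A)"
  unfolding hausdorff_null_def
proof (intro allI impI)
  fix \<epsilon> :: real assume \<epsilon>: "0 < \<epsilon>"
  then have "0 < \<epsilon> / L powr d" using assms by simp
  from hausdorff_nullE[OF assms(1) this] obtain U :: "nat \<Rightarrow> 'a set" where
    U: "A \<subseteq> (\<Union>i. U i)" "\<And>i. bounded (U i)" "(\<Sum>i. diam_power d (U i)) \<le> ennreal (\<epsilon> / L powr d)"
    by metis
  define V where "V i = f ` (U i \<inter> A)" for i
  have d: "dist v w \<le> L * diameter (U i)" if "v \<in> V i" "w \<in> V i" for v w i
  proof -
    obtain x y where xy: "x \<in> U i \<inter> A" "y \<in> U i \<inter> A" "v = f x" "w = f y"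
      using \<open>v \<in> V i\<close> \<open>w \<in> V i\<close> unfolding V_def by blast
    have "dist v w \<le> L * dist x y" using assms(4)[of x y] xy by auto
    also have "\<dots> \<le> L * diameter (U i)"
      using xy U(2) assms(3) by (intro mult_left_mono diameter_bounded_bound) auto
    finally show ?thesis .
  qed
  have bV: "bounded (V i)" for i
    unfolding bounded_two_points using d by blast
  have "diam_power d (V i) \<le> ennreal (L powr d) * diam_power d (U i)" for i
  proof -
    have dU: "0 \<le> diameter (U i)" using U(2) by (rule diameter_ge_0)
    then have "diameter (V i) \<le> L * diameter (U i)"
      using d[of _ i] assms(3) by (intro diameter_le) (auto simp: dist_norm)
    then have "diameter (V i) powr d \<le> (L * diameter (U i)) powr d"
      using assms(2) bV by (intro powr_mono2 diameter_ge_0) auto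
    also have "\<dots> = L powr d * diameter (U i) powr d"
      using assms(3) dU by (simp add: powr_mult)
    finally show ?thesis
      using assms(2) by (simp add: diam_power_pos ennreal_leI flip: ennreal_mult)
  qed
  then have "(\<Sum>i. diam_power d (V i)) \<le> (\<Sum>i. ennreal (L powr d) * diam_power d (U i))"
    by (intro suminf_le summableI)
  also have "\<dots> \<le> ennreal (L powr d) * ennreal (\<epsilon> / L powr d)"
    using U(3) by (simp add: ennreal_suminf_cmult mult_left_mono)
  also have "\<dots> = ennreal \<epsilon>" using assms \<epsilon> by (simp flip: ennreal_mult)
  finally have "(\<Sum>i. diam_power d (V i)) \<le> ennreal \<epsilon>" .
  moreover have "f ` A \<subseteq> (\<Union>i. V i)" using U(1) unfolding V_def by blast
  ultimately show "\<exists>V :: nat \<Rightarrow> 'b set. f ` A \<subseteq> (\<Union>n. V n) \<and> (\<forall>n. bounded (V n)) \<and>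
      (\<Sum>n. diam_power d (V n)) \<le> ennreal \<epsilon>" using bV by blast
qed

text \<open>
  The covers used below consist of the fibres of a function \<open>F\<close> with finitely many values.
\<close>

lemma cover_by_classes:
  fixes A :: "'a::real_normed_vector set"
  assumes fin: "finite (F ` A)" and "real (card (F ` A)) \<le> N" and "0 < d" "0 \<le> \<eta>"
    and close: "\<And>x y. x \<in> A \<Longrightarrow> y \<in> A \<Longrightarrow> F x = F y \<Longrightarrow> dist x y \<le> \<eta>"
  shows "\<exists>U :: nat \<Rightarrow> 'a set. A \<subseteq> (\<Union>i. U i) \<and> (\<forall>i. bounded (U i)) \<and>
      (\<Sum>i. diam_power d (U i)) \<le> ennreal (N * \<eta> powr d)"
proof -
  define k where "k = card (F ` A)"
  obtain h where h: "bij_betw h {..<k} (F ` A)"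
    using ex_bij_betw_nat_finite[OF fin] by (auto simp: k_def atLeast0LessThan)
  define U where "U i = {x \<in> A. i < k \<and> F x = h i}" for i
  have d: "dist x y \<le> \<eta>" if "x \<in> U i" "y \<in> U i" for x y i
    using that close by (auto simp: U_def)
  then have b: "bounded (U i)" for i unfolding bounded_two_points by blast
  have diam: "diam_power d (U i) \<le> ennreal (\<eta> powr d)" for i
  proof -
    have "diameter (U i) \<le> \<eta>"
      using d[of _ i] assms(4) by (intro diameter_le) (auto simp: dist_norm)
    then show ?thesis
      using assms(3) diameter_ge_0[OF b] by (simp add: diam_power_pos ennreal_leI powr_mono2)
  qed
  have "(\<Sum>i. diam_power d (U i)) = (\<Sum>i<k. diam_power d (U i))"
    by (rule suminf_finite) (auto simp: U_def diam_power_def)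
  also have "\<dots> \<le> (\<Sum>i<k. ennreal (\<eta> powr d))" by (intro sum_mono diam)
  also have "\<dots> = ennreal (real k * \<eta> powr d)" by (simp add: ennreal_mult ennreal_of_nat_eq_real_of_nat)
  also have "\<dots> \<le> ennreal (N * \<eta> powr d)"
    using assms(2) by (intro ennreal_leI mult_right_mono) (auto simp: k_def)
  finally have "(\<Sum>i. diam_power d (U i)) \<le> ennreal (N * \<eta> powr d)" .
  moreover have "A \<subseteq> (\<Union>i. U i)"
  proof
    fix x assume x: "x \<in> A"
    then have "F x \<in> h ` {..<k}" using h by (simp add: bij_betw_def)
    then obtain i where "F x = h i" "i < k" by (auto elim: imageE)
    then have "x \<in> U i" using x by (simp add: U_def)
    then show "x \<in> (\<Union>i. U i)" by (rule UN_I[OF UNIV_I])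
  qed
  ultimately show ?thesis using b by blast
qed

text \<open>
  A set of diameter \<open>D\<close> lies in a cube with side \<open>2D\<close>.
\<close>

lemma hausdorff_null_imp_negligible:
  fixes A :: "'a::euclidean_space set"
  assumes "hausdorff_null (DIM('a)) A"
  shows "negligible A"
  unfolding negligible_outer_le
proof (intro allI impI)
  fix e :: real assume e: "0 < e"
  define n where "n = DIM('a)"
  have "0 < e / 2 ^ n" using e by simp
  from hausdorff_nullE[OF assms this] obtain U :: "nat \<Rightarrow> 'a set" where
    U: "A \<subseteq> (\<Union>i. U i)" "\<And>i. bounded (U i)"
      "(\<Sum>i. diam_power (real DIM('a)) (U i)) \<le> ennreal (e / 2 ^ n)"
    by metis
  define V where "V i = (if U i = {} then {} else
      cbox ((SOME x. x \<in> U i) - diameter (U i) *\<^sub>R One) ((SOME x. x \<in> U i) + diameter (U i) *\<^sub>R One))" for i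
  have UV: "U i \<subseteq> V i" for i
  proof
    fix y assume y: "y \<in> U i"
    define x where "x = (SOME x. x \<in> U i)"
    have "x \<in> U i" using y unfolding x_def by (rule someI)
    then have "dist x y \<le> diameter (U i)" using y U(2) by (intro diameter_bounded_bound) auto
    then have "\<bar>(y - x) \<bullet> b\<bar> \<le> diameter (U i)" if "b \<in> Basis" for b
      using Basis_le_norm[OF that, of "y - x"] by (simp add: dist_norm norm_minus_commute)
    then show "y \<in> V i" using y
      by (auto simp: V_def mem_box x_def[symmetric] abs_le_iff algebra_simps inner_diff_left inner_add_left)
  qed
  have meas: "emeasure lborel (V i) \<le> ennreal (2 ^ n) * diam_power (real DIM('a)) (U i)" for i
  proof (cases "U i = {}")
    case False
    define x D where "x = (SOME x. x \<in> U i)" and "D = diameter (U i)"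
    have D: "0 \<le> D" unfolding D_def using U(2) by (rule diameter_ge_0)
    have "emeasure lborel (V i) = ennreal (\<Prod>b\<in>Basis. ((x + D *\<^sub>R One) - (x - D *\<^sub>R One)) \<bullet> (b::'a))"
      unfolding V_def x_def[symmetric] D_def[symmetric] using False D
      by (auto simp: inner_diff_left inner_add_left intro!: emeasure_lborel_cbox)
    also have "(\<Prod>b\<in>Basis. ((x + D *\<^sub>R One) - (x - D *\<^sub>R One)) \<bullet> (b::'a)) = (\<Prod>b\<in>(Basis::'a set). 2 * D)"
      by (intro prod.cong) (auto simp: inner_diff_left inner_add_left)
    also have "\<dots> = 2 ^ n * D powr (real DIM('a))"
      using D by (simp add: n_def power_mult_distrib powr_realpow')
    finally show ?thesis by (simp add: diam_power_pos D_def ennreal_mult)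
  qed (simp add: V_def)
  have borel: "V i \<in> sets lborel" for i by (simp add: V_def)
  define T where "T = (\<Union>i. V i)"
  have "emeasure lborel T \<le> (\<Sum>i. emeasure lborel (V i))"
    unfolding T_def using borel by (intro emeasure_subadditive_countably) auto
  also have "\<dots> \<le> (\<Sum>i. ennreal (2 ^ n) * diam_power (real DIM('a)) (U i))"
    by (intro suminf_le summableI meas)
  also have "\<dots> \<le> ennreal (2 ^ n) * ennreal (e / 2 ^ n)"
    using U(3) by (simp only: ennreal_suminf_cmult) (intro mult_left_mono, auto)
  also have "\<dots> = ennreal e" using e by (simp flip: ennreal_mult)
  finally have T: "emeasure lborel T \<le> ennreal e" .
  have Tb: "T \<in> sets lborel" unfolding T_def using borel by blast
  then have T': "emeasure lebesgue T \<le> ennreal e" using T by simp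
  have "T \<in> lmeasurable"
    using T' Tb by (intro fmeasurableI) (auto intro: le_less_trans)
  moreover have "measure lebesgue T \<le> e"
    using T' e by (simp add: measure_def enn2real_leI)
  moreover have "A \<subseteq> T" using U(1) UV unfolding T_def by blast
  ultimately show "\<exists>T. A \<subseteq> T \<and> T \<in> lmeasurable \<and> measure lebesgue T \<le> e" by blast
qed

lemma floor_eq_imp_close:
  fixes x y h :: real
  assumes "0 < h" "\<lfloor>x / h\<rfloor> = \<lfloor>y / h\<rfloor>" shows "\<bar>x - y\<bar> \<le> h"
proof -
  have "\<bar>x / h - y / h\<bar> < 1" using assms(2) by linarith
  then show ?thesis using assms(1) by (simp add: abs_divide field_simps flip: diff_divide_distrib)
qed

text \<open>
  A square of side \<open>2k\<close> consists of about \<open>(2kn)\<^sup>2\<close> squares of side \<open>1/n\<close>.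
\<close>

lemma hausdorff_null_complex:
  assumes "2 < d" shows "hausdorff_null d (A :: complex set)"
proof -
  define S where "S k = {z. \<bar>Re z\<bar> \<le> real k \<and> \<bar>Im z\<bar> \<le> real k}" for k :: nat
  have "hausdorff_null d (S k)" for k
    unfolding hausdorff_null_def
  proof (intro allI impI)
    fix \<epsilon> :: real assume \<epsilon>: "0 < \<epsilon>"
    define C where "C = (2 * real k + 3) ^ 2 * 2 powr d"
    have "((\<lambda>n. C * real n powr (2 - d)) \<longlongrightarrow> C * 0) sequentially"
      using assms by (intro tendsto_intros tendsto_neg_powr filterlim_real_sequentially) auto
    then have "\<forall>\<^sub>F n in sequentially. C * real n powr (2 - d) < \<epsilon>"
      using \<epsilon> by (intro order_tendstoD) auto
    then have "\<forall>\<^sub>F n in sequentially. C * real n powr (2 - d) < \<epsilon> \<and> 1 \<le> n"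
      by (intro eventually_conj eventually_ge_at_top)
    then obtain n :: nat where n: "C * real n powr (2 - d) < \<epsilon>" "1 \<le> n"
      by (auto simp: eventually_sequentially)
    define F where "F z = (\<lfloor>Re z / (1 / n)\<rfloor>, \<lfloor>Im z / (1 / n)\<rfloor>)" for z
    define B where "B = {- int (k * n)..int (k * n)}"
    have "\<lfloor>x / (1 / n)\<rfloor> \<in> B" if "\<bar>x\<bar> \<le> real k" for x :: real
    proof -
      have "\<bar>x * n\<bar> \<le> real k * n" using that n by (simp add: abs_mult)
      then have "- real (k * n) \<le> x * n" "x * n \<le> real (k * n)" by (auto simp: abs_le_iff)
      then show ?thesis by (simp add: B_def le_floor_iff floor_le_iff)
    qed
    then have FB: "F ` S k \<subseteq> B \<times> B" by (auto simp: F_def S_def)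
    then have fin: "finite (F ` S k)" by (rule finite_subset) (simp add: B_def)
    have "card B = 2 * (k * n) + 1" unfolding B_def card_atLeastAtMost_int by linarith
    moreover have "card (F ` S k) \<le> card (B \<times> B)" using FB by (intro card_mono) (auto simp: B_def)
    ultimately have "card (F ` S k) \<le> (2 * (k * n) + 1) ^ 2"
      by (simp only: card_cartesian_product power2_eq_square)
    then have "real (card (F ` S k)) \<le> real ((2 * (k * n) + 1) ^ 2)" by (rule of_nat_mono)
    also have "\<dots> = (2 * real k * n + 1) ^ 2" by simp
    also have "\<dots> \<le> ((2 * real k + 3) * n) ^ 2"
      using n by (intro power_mono) (auto simp: algebra_simps)
    finally have N: "real (card (F ` S k)) \<le> ((2 * real k + 3) * n) ^ 2" .
    have "dist z w \<le> 2 / n" if "F z = F w" for z w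
    proof -
      have "\<bar>Re z - Re w\<bar> \<le> 1 / n" "\<bar>Im z - Im w\<bar> \<le> 1 / n"
        using that n by (auto intro!: floor_eq_imp_close simp: F_def)
      then show ?thesis using cmod_le[of "z - w"] by (simp add: dist_norm)
    qed
    then have "\<exists>U. S k \<subseteq> (\<Union>i. U i) \<and> (\<forall>i. bounded (U i)) \<and>
        (\<Sum>i. diam_power d (U i)) \<le> ennreal (((2 * real k + 3) * n) ^ 2 * (2 / n) powr d)"
      using fin N assms by (intro cover_by_classes[of F]) auto
    moreover have "((2 * real k + 3) * n) ^ 2 * (2 / n) powr d = C * real n powr (2 - d)"
    proof -
      have n0: "0 < real n" using n(2) by simp
      have "real n powr (2 - d) = real n powr 2 / real n powr d" by (rule powr_diff)
      also have "real n powr 2 = real n ^ 2" using n0 by simp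
      finally have 1: "real n powr (2 - d) = real n ^ 2 / real n powr d" .
      have 2: "(2 / real n) powr d = 2 powr d / real n powr d" by (rule powr_divide)
      show ?thesis unfolding 1 2 C_def power_mult_distrib by (simp only: times_divide_eq_right times_divide_eq_left mult.assoc mult.commute mult.left_commute)
    qed
    ultimately show "\<exists>U. S k \<subseteq> (\<Union>i. U i) \<and> (\<forall>i. bounded (U i)) \<and>
        (\<Sum>i. diam_power d (U i)) \<le> ennreal \<epsilon>"
      using n by (metis ennreal_leI less_imp_le order_trans)
  qed
  then have "hausdorff_null d (\<Union>k. S k)" by (rule hausdorff_null_UN_nat)
  moreover have "A \<subseteq> (\<Union>k. S k)"
  proof
    fix z assume "z \<in> A"
    obtain k :: nat where "\<bar>Re z\<bar> + \<bar>Im z\<bar> \<le> real k" using real_arch_simple by blast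
    then have "z \<in> S k" unfolding S_def mem_Collect_eq by linarith
    then show "z \<in> (\<Union>k. S k)" by blast
  qed
  ultimately show ?thesis by (rule hausdorff_null_mono)
qed

section \<open>The dimension of the union of the curves\<close>

text \<open>
  Points whose orbit grows at full speed from the start and never leaves the squeezed middle half of
  the wedges: the wedge of level \<open>4 Re z\<close> has half-width \<open>8 + 4 Re z\<close>. Every orbit of positive
  potential enters such a set (lemma \<open>ray_enters_escape_core\<close>).
\<close>

definition escape_core :: "nat \<Rightarrow> complex set" where
  "escape_core M = {z. Re z \<le> real M \<and> \<bar>Im z\<bar> \<le> real M \<and>
     (\<forall>n. 4 ^ n \<le> Re ((phi ^^ n) z) \<and> \<bar>Im ((phi ^^ Suc n) z)\<bar> \<le> 4 + 2 * Re ((phi ^^ n) z))}"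

lemma escape_core_nonneg: "z \<in> escape_core M \<Longrightarrow> 0 \<le> Re z"
  unfolding escape_core_def by (auto dest: spec[of _ 0])

text \<open>
  In the squeezed zone \<open>psi j\<close> multiplies the position on the wedge by a slope of size \<open>exp (-a)\<close>, and
  this slope varies with the level by no more than the same factor.
\<close>

lemma strip_thinning:
  assumes nonneg: "0 \<le> Re u" "0 \<le> Re v"
    and strip: "\<bar>Im u - 2 * of_int j\<bar> \<le> 1" "\<bar>Im v - 2 * of_int j\<bar> \<le> 1"
    and mid: "\<bar>Im (phi u)\<bar> \<le> 4 + 2 * Re u" "\<bar>Im (phi v)\<bar> \<le> 4 + 2 * Re v"
    and a: "a \<le> 4 * Re u" "a \<le> 4 * Re v"
  shows "\<bar>Im u - Im v\<bar> \<le> exp (- a) / 4 * (\<bar>Im (phi u) - Im (phi v)\<bar> + 4 * \<bar>Re u - Re v\<bar>)"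
proof -
  define t where "t w = Im (phi w) / (8 + 4 * Re w)" for w
  have Im: "Im w = 2 * of_int j + parity_sign j * (slope (4 * Re w) * t w)" and t: "\<bar>t w\<bar> \<le> 1/2"
    if "0 \<le> Re w" "\<bar>Im w - 2 * of_int j\<bar> \<le> 1" "\<bar>Im (phi w)\<bar> \<le> 4 + 2 * Re w" for w
  proof -
    show t: "\<bar>t w\<bar> \<le> 1/2" using that by (simp add: t_def abs_divide divide_le_eq)
    have "squeeze (slope (4 * Re w)) (t w) = slope (4 * Re w) * t w"
      using t slope_le[of "4 * Re w"] that by (intro squeeze_middle slope_pos) auto
    then show "Im w = 2 * of_int j + parity_sign j * (slope (4 * Re w) * t w)"
      using Im_psi[of j "phi w"] psi_phi[OF that(1,2)] by (simp add: t_def)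
  qed
  define r r' where "r = 4 * Re u" and "r' = 4 * Re v"
  have "\<bar>t u - t v\<bar> \<le> (\<bar>Im (phi u) - Im (phi v)\<bar> + \<bar>r - r'\<bar>) / 8"
    unfolding t_def r_def r'_def using nonneg t[OF nonneg(2) strip(2) mid(2)]
    by (intro quotient_diff) (auto simp: t_def)
  moreover have "\<bar>slope r - slope r'\<bar> \<le> exp (- a) / 4 * \<bar>r - r'\<bar>"
    using a by (intro slope_diff) (auto simp: r_def r'_def)
  moreover have "\<bar>slope r * t u - slope r' * t v\<bar> \<le> exp (- a) / 4 * \<bar>t u - t v\<bar> + 1/2 * \<bar>slope r - slope r'\<bar>"
    using a t[OF nonneg(2) strip(2) mid(2)]
    by (intro product_diff) (auto simp: slope_def r_def)
  ultimately have "\<bar>slope r * t u - slope r' * t v\<bar> \<le> exp (- a) / 4 * ((\<bar>Im (phi u) - Im (phi v)\<bar> + \<bar>r - r'\<bar>) / 8)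
      + 1/2 * (exp (- a) / 4 * \<bar>r - r'\<bar>)"
    by (smt (verit) mult_left_mono exp_gt_zero divide_pos_pos)
  also have "\<dots> = exp (- a) / 4 * (\<bar>Im (phi u) - Im (phi v)\<bar> / 8 + 5/8 * \<bar>r - r'\<bar>)"
    by (simp add: field_simps)
  also have "\<dots> \<le> exp (- a) / 4 * (\<bar>Im (phi u) - Im (phi v)\<bar> + 4 * \<bar>Re u - Re v\<bar>)"
  proof (rule mult_left_mono)
    show "\<bar>Im (phi u) - Im (phi v)\<bar> / 8 + 5/8 * \<bar>r - r'\<bar> \<le> \<bar>Im (phi u) - Im (phi v)\<bar> + 4 * \<bar>Re u - Re v\<bar>"
    proof -
      have "\<bar>r - r'\<bar> = 4 * \<bar>Re u - Re v\<bar>" by (simp add: r_def r'_def abs_if)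
      then show ?thesis
        using abs_ge_zero[of "Im (phi u) - Im (phi v)"] abs_ge_zero[of "Re u - Re v"] by argo
    qed
  qed simp
  also have "\<bar>slope r * t u - slope r' * t v\<bar> = \<bar>Im u - Im v\<bar>"
  proof -
    have "Im u - Im v = parity_sign j * (slope r * t u - slope r' * t v)"
      using Im[OF nonneg(1) strip(1) mid(1)] Im[OF nonneg(2) strip(2) mid(2)]
      by (simp add: r_def r'_def right_diff_distrib)
    then show ?thesis by (simp add: abs_mult)
  qed
  finally show ?thesis .
qed

text \<open>
  Twice the slope at the level \<open>4\<^bsup>i+1\<^esup>\<close>, the lowest one that an orbit in \<open>escape_core M\<close> can have at time
  \<open>i + 1\<close>. The factor 2 arises in \<open>cylinder_thickness\<close>.
\<close>

definition thin :: "nat \<Rightarrow> real" where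
  "thin i = exp (- (4 ^ Suc i)) / 2"

lemma thin_pos: "0 < thin i"
  by (simp add: thin_def)

lemma thin_le: "thin i \<le> 1/8"
proof -
  have "(4::real) \<le> 4 ^ Suc i" by simp
  also have "4 ^ Suc i \<le> exp (4 ^ Suc i :: real)"
    using exp_ge_add_one_self[of "4 ^ Suc i :: real"] by linarith
  finally have "inverse (exp (4 ^ Suc i)) \<le> inverse (4 :: real)"
    by (rule le_imp_inverse_le) (rule zero_less_numeral)
  then have "inverse (exp (4 ^ Suc i)) \<le> (1 / 4 :: real)"
    by (simp only: inverse_eq_divide[of "4::real"])
  then show ?thesis unfolding thin_def exp_minus by linarith
qed

text \<open>
  Two points that share their strips up to time \<open>n\<close> lie almost on a common graph of slope at most
  \<open>1/2\<close> over the real axis; the error is the product of the thinning factors. The proof goes back from time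
  \<open>n\<close>: the difference \<open>Y\<close> of the next imaginary parts is bounded by the induction hypothesis in terms of
  the next real parts, which in turn differ by at most \<open>4 X + Y\<close>, and this is solved for \<open>Y\<close>. The factor
  \<open>thin j \<le> 1/8\<close> restores the slope \<open>1/2\<close>.
\<close>

lemma cylinder_thickness:
  assumes z: "z \<in> escape_core M" and w: "w \<in> escape_core M"
    and cell: "\<And>i. i \<le> n \<Longrightarrow> \<bar>Im ((phi ^^ i) z) - 2 * of_int (s i)\<bar> \<le> 1"
      "\<And>i. i \<le> n \<Longrightarrow> \<bar>Im ((phi ^^ i) w) - 2 * of_int (s i)\<bar> \<le> 1"
    and "j \<le> n"
  shows "\<bar>Im ((phi ^^ j) z) - Im ((phi ^^ j) w)\<bar>
    \<le> 2 * (\<Prod>i=j..<n. thin i) + 1/2 * \<bar>Re ((phi ^^ j) z) - Re ((phi ^^ j) w)\<bar>"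
  using \<open>j \<le> n\<close>
proof (induction j rule: inc_induct)
  case base
  have "\<bar>Im ((phi ^^ n) z) - Im ((phi ^^ n) w)\<bar> \<le> 2" using cell[of n] by linarith
  then show ?case by (simp add: add_increasing2)
next
  case (step j)
  define u v where "u = (phi ^^ j) z" and "v = (phi ^^ j) w"
  define X where "X = \<bar>Re u - Re v\<bar>"
  define Y where "Y = \<bar>Im (phi u) - Im (phi v)\<bar>"
  define P where "P = 2 * (\<Prod>i=Suc j..<n. thin i)"
  have large: "4 ^ j \<le> Re u" "4 ^ j \<le> Re v" "\<bar>Im (phi u)\<bar> \<le> 4 + 2 * Re u" "\<bar>Im (phi v)\<bar> \<le> 4 + 2 * Re v"
    using z w by (auto simp: escape_core_def u_def v_def)
  have pos: "0 \<le> Re u" "0 \<le> Re v" using large(1,2) by (smt (verit) zero_le_power)+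
  have "Y \<le> P + 1/2 * \<bar>Re (phi u) - Re (phi v)\<bar>"
    using step.IH by (simp add: Y_def P_def u_def v_def)
  moreover have "\<bar>Re (phi u) - Re (phi v)\<bar> \<le> 4 * X + Y"
  proof -
    have "Re (phi u) - Re (phi v) = 4 * (Re u - Re v) - (overhang (Im (phi u)) - overhang (Im (phi v)))"
      by (simp add: Re_phi)
    then have "\<bar>Re (phi u) - Re (phi v)\<bar> \<le> \<bar>4 * (Re u - Re v)\<bar> + \<bar>overhang (Im (phi u)) - overhang (Im (phi v))\<bar>"
      by (simp only: abs_triangle_ineq4)
    also have "\<dots> \<le> 4 * X + Y"
      unfolding X_def Y_def by (intro add_mono overhang_diff) (simp only: abs_mult abs_numeral order_refl)
    finally show ?thesis .
  qed
  ultimately have Y: "Y + 4 * X \<le> 2 * P + 8 * X" by simp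
  have "\<bar>Im u - Im v\<bar> \<le> exp (- (4 ^ Suc j)) / 4 * (Y + 4 * X)"
    unfolding X_def Y_def using large pos cell[of j] step.hyps
    by (intro strip_thinning[where j = "s j"]) (auto simp: u_def v_def)
  also have "\<dots> = thin j / 2 * (Y + 4 * X)" by (simp add: thin_def)
  also have "\<dots> \<le> thin j / 2 * (2 * P + 8 * X)"
    using Y thin_pos[of j] by (intro mult_left_mono) auto
  also have "\<dots> = thin j * P + 4 * (thin j * X)" by (simp add: algebra_simps)
  also have "\<dots> \<le> thin j * P + 1/2 * X"
    using mult_right_mono[OF thin_le[of j], of X] by (simp add: X_def)
  also have "thin j * P = 2 * (\<Prod>i=j..<n. thin i)"
    using step.hyps by (simp add: P_def prod.atLeast_Suc_lessThan)
  finally show ?case by (simp add: u_def v_def X_def)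
qed

lemma Re_funpow_le: "Re ((phi ^^ n) z) \<le> 4 ^ n * Re z"
proof (induction n)
  case (Suc n)
  have "Re ((phi ^^ Suc n) z) \<le> 4 * Re ((phi ^^ n) z)" by (simp add: Re_phi)
  then show ?case using Suc.IH by simp
qed simp

lemma escape_core_cell_bound:
  assumes "z \<in> escape_core M"
  shows "\<bar>\<lfloor>(Im ((phi ^^ i) z) + 1) / 2\<rfloor>\<bar> \<le> int ((M + 5) * 4 ^ i)"
proof -
  have "\<bar>Im ((phi ^^ i) z)\<bar> \<le> (real M + 4) * 4 ^ i"
  proof (cases i)
    case 0
    then show ?thesis using assms by (simp add: escape_core_def)
  next
    case (Suc k)
    have "\<bar>Im ((phi ^^ i) z)\<bar> \<le> 4 + 2 * Re ((phi ^^ k) z)"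
      using assms unfolding Suc escape_core_def by blast
    also have "\<dots> \<le> 4 + 2 * (4 ^ k * real M)"
      using order_trans[OF Re_funpow_le mult_left_mono[of "Re z" "real M" "4 ^ k"]] assms
      by (auto simp: escape_core_def)
    also have "\<dots> \<le> 4 * 4 ^ i + real M * 4 ^ i"
      using one_le_power[of "4::real" i] by (intro add_mono) (auto simp: Suc)
    finally show ?thesis by (simp add: algebra_simps)
  qed
  moreover have "(1::real) \<le> 4 ^ i" by simp
  moreover have "(real M + 5) * 4 ^ i = (real M + 4) * 4 ^ i + 4 ^ i" by (simp add: algebra_simps)
  ultimately have "\<bar>Im ((phi ^^ i) z)\<bar> + 1 \<le> (real M + 5) * 4 ^ i" by linarith
  then have *: "- real ((M + 5) * 4 ^ i) \<le> (Im ((phi ^^ i) z) + 1) / 2"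
    "(Im ((phi ^^ i) z) + 1) / 2 \<le> real ((M + 5) * 4 ^ i)"
    by (auto simp: abs_le_iff)
  have "of_int (- int ((M + 5) * 4 ^ i)) \<le> (Im ((phi ^^ i) z) + 1) / 2"
    using *(1) by (simp only: of_int_minus of_int_of_nat_eq)
  then have "- int ((M + 5) * 4 ^ i) \<le> \<lfloor>(Im ((phi ^^ i) z) + 1) / 2\<rfloor>"
    by (simp only: le_floor_iff)
  moreover have "\<lfloor>(Im ((phi ^^ i) z) + 1) / 2\<rfloor> \<le> int ((M + 5) * 4 ^ i)"
    using floor_mono[OF *(2)] by (simp only: floor_of_nat)
  ultimately show ?thesis by linarith
qed

lemma prod_tendsto_0:
  fixes a :: "nat \<Rightarrow> real"
  assumes "a \<longlonglongrightarrow> 0"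
  shows "(\<lambda>n. \<Prod>i<n. a i) \<longlonglongrightarrow> 0"
proof -
  have "\<forall>\<^sub>F n in sequentially. norm (a n) < 1/2"
    using tendsto_norm[OF assms] by (intro order_tendstoD(2)) auto
  then obtain N where N: "\<And>n. n \<ge> N \<Longrightarrow> norm (a n) < 1/2" by (auto simp: eventually_sequentially)
  have "summable (\<lambda>n. \<Prod>i<n. a i)"
  proof (rule summable_ratio_test[of "1/2" N])
    fix n assume "n \<ge> N"
    then show "norm (\<Prod>i<Suc n. a i) \<le> 1/2 * norm (\<Prod>i<n. a i)"
      using mult_right_mono[of "\<bar>a n\<bar>" "1/2" "\<bar>\<Prod>i<n. a i\<bar>"] N[of n]
      by (simp add: abs_mult mult.commute)
  qed simp
  then show ?thesis by (rule summable_LIMSEQ_zero)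
qed

lemma filterlim_power_of_4: "filterlim (\<lambda>n. 4 ^ n :: real) at_top sequentially"
proof (rule filterlim_at_top_mono[OF filterlim_real_sequentially])
  have "real n \<le> 4 ^ n" for n
  proof (induction n)
    case (Suc n)
    have "1 + real n \<le> 4 * 4 ^ n" using Suc one_le_power[of "4::real" n] by linarith
    then show ?case by simp
  qed simp
  then show "\<forall>\<^sub>F n in sequentially. real n \<le> 4 ^ n" by simp
qed

text \<open>
  The factors tend to 0 because they have the form \<open>x * exp (- c * x)\<close>, up to a constant, at \<open>x = 4\<^bsup>i+1\<^esup>\<close>.
\<close>

lemma growth_beaten_by_thinning:
  assumes "0 < c"
  shows "(\<lambda>n. \<Prod>i<n. K * 4 ^ Suc i * thin i powr c) \<longlonglongrightarrow> 0"
proof (rule prod_tendsto_0)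
  have "filterlim (\<lambda>i. c * 4 ^ Suc i) at_top sequentially"
    using assms by (intro filterlim_tendsto_pos_mult_at_top[OF tendsto_const]
        filterlim_compose[OF filterlim_power_of_4 filterlim_Suc])
  from filterlim_compose[OF tendsto_power_div_exp_0[of 1] this]
  have "(\<lambda>i. c * 4 ^ Suc i / exp (c * 4 ^ Suc i)) \<longlonglongrightarrow> 0" by simp
  then have "(\<lambda>i. K / (c * 2 powr c) * (c * 4 ^ Suc i / exp (c * 4 ^ Suc i))) \<longlonglongrightarrow> K / (c * 2 powr c) * 0"
    by (intro tendsto_intros)
  moreover have "K / (c * 2 powr c) * (c * 4 ^ Suc i / exp (c * 4 ^ Suc i)) = K * 4 ^ Suc i * thin i powr c" for i
  proof -
    have "thin i powr c = 1 / (exp (c * 4 ^ Suc i) * 2 powr c)"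
    proof -
      have "thin i powr c = exp (- (4 ^ Suc i)) powr c / 2 powr c"
        unfolding thin_def by (rule powr_divide)
      also have "exp (- (4 ^ Suc i)) powr c = exp (- (c * 4 ^ Suc i))"
        unfolding exp_powr_real by (simp add: mult.commute)
      finally show ?thesis unfolding exp_minus by (simp only: divide_inverse inverse_mult_distrib mult_1_left)
    qed
    then show ?thesis using assms by (simp only:) (simp add: field_simps)
  qed
  ultimately show "(\<lambda>i. K * 4 ^ Suc i * thin i powr c) \<longlonglongrightarrow> 0" by simp
qed

text \<open>
  Let \<open>\<theta>\<close> be the thickness of the cylinders of depth \<open>n\<close>. There are at most \<open>\<Prod>i\<le>n. K 4\<^sup>i\<close> cylinders, and
  each is covered by about \<open>M / \<theta>\<close> pieces of diameter at most \<open>3 \<theta>\<close>. The resulting sum is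
  a constant times \<open>(\<Prod>i\<le>n. K 4\<^sup>i) \<theta>\<^bsup>d-1\<^esup>\<close>, which tends to 0 since \<open>d > 1\<close> and \<open>\<theta>\<close> is a product of
  factors \<open>exp (- (4\<^bsup>i+1\<^esup>)) / 2\<close>.
\<close>

lemma hausdorff_null_escape_core:
  assumes d: "1 < d" shows "hausdorff_null d (escape_core M)"
  unfolding hausdorff_null_def
proof (intro allI impI)
  fix \<epsilon> :: real assume \<epsilon>: "0 < \<epsilon>"
  define K where "K = 3 * (real M + 5)"
  define C where "C = (real M + 2) * K * 3 powr d * 2 powr (d - 1)"
  have "(\<lambda>n. C * (\<Prod>i<n. K * 4 ^ Suc i * thin i powr (d - 1))) \<longlonglongrightarrow> C * 0"
    using d by (intro tendsto_intros growth_beaten_by_thinning) auto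
  then have "\<forall>\<^sub>F n in sequentially. C * (\<Prod>i<n. K * 4 ^ Suc i * thin i powr (d - 1)) < \<epsilon>"
    using \<epsilon> by (intro order_tendstoD) auto
  then obtain n where n: "C * (\<Prod>i<n. K * 4 ^ Suc i * thin i powr (d - 1)) < \<epsilon>"
    by (auto simp: eventually_sequentially)
  define \<theta> where "\<theta> = 2 * (\<Prod>i<n. thin i)"
  have \<theta>0: "0 < \<theta>" by (simp add: \<theta>_def prod_pos thin_pos)
  have \<theta>2: "\<theta> \<le> 2"
  proof -
    have "thin i \<le> 1" for i using thin_le[of i] by linarith
    then have "(\<Prod>i<n. thin i) \<le> 1" using thin_pos by (intro prod_le_1) (simp add: less_imp_le)
    then show ?thesis by (simp add: \<theta>_def)
  qed
  define cell where "cell z i = \<lfloor>(Im ((phi ^^ i) z) + 1) / 2\<rfloor>" for z and i :: nat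
  \<comment> \<open>A piece is given by its strips up to time n and an interval of length \<open>\<theta>\<close> for the real part.\<close>
  define F where "F z = (restrict (cell z) {..n}, \<lfloor>Re z / \<theta>\<rfloor>)" for z
  define b where "b i = int ((M + 5) * 4 ^ i)" for i :: nat
  define I where "I = PiE {..n} (\<lambda>i. {- b i..b i}) \<times> {0..\<lfloor>real M / \<theta>\<rfloor>}"
  have finI: "finite I" by (auto simp: I_def intro!: finite_PiE)
  have "F z \<in> I" if "z \<in> escape_core M" for z
  proof -
    have "- b i \<le> cell z i \<and> cell z i \<le> b i" for i
      using escape_core_cell_bound[OF that, of i] by (auto simp: cell_def b_def abs_le_iff)
    moreover have "0 \<le> \<lfloor>Re z / \<theta>\<rfloor>" using escape_core_nonneg[OF that] \<theta>0 by simp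
    moreover have "\<lfloor>Re z / \<theta>\<rfloor> \<le> \<lfloor>real M / \<theta>\<rfloor>"
      using that \<theta>0 by (intro floor_mono divide_right_mono) (auto simp: escape_core_def)
    ultimately show ?thesis by (auto simp: F_def I_def)
  qed
  then have FI: "F ` escape_core M \<subseteq> I" by blast
  have cardI: "real (card I) \<le> (\<Prod>i\<le>n. K * 4 ^ i) * ((real M + 2) / \<theta>)"
  proof -
    have "real (card {- b i..b i}) \<le> K * 4 ^ i" for i
    proof -
      have "card {- b i..b i} = 2 * ((M + 5) * 4 ^ i) + 1"
        unfolding b_def card_atLeastAtMost_int by linarith
      then have "real (card {- b i..b i}) = 2 * ((real M + 5) * 4 ^ i) + 1" by simp
      moreover have "1 \<le> (real M + 5) * 4 ^ i"
        using mult_mono[of 1 "real M + 5" 1 "4 ^ i"] by simp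
      moreover have "K * 4 ^ i = 3 * ((real M + 5) * 4 ^ i)" by (simp only: K_def mult.assoc)
      ultimately show ?thesis by linarith
    qed
    then have "(\<Prod>i\<le>n. real (card {- b i..b i})) \<le> (\<Prod>i\<le>n. K * 4 ^ i)"
      by (intro prod_mono) auto
    moreover have "real (card {0..\<lfloor>real M / \<theta>\<rfloor>}) \<le> (real M + 2) / \<theta>"
    proof -
      have "0 \<le> real M / \<theta>" using \<theta>0 by simp
      then have "real (card {0..\<lfloor>real M / \<theta>\<rfloor>}) \<le> real M / \<theta> + 1"
        unfolding card_atLeastAtMost_int by linarith
      also have "\<dots> \<le> (real M + 2) / \<theta>" using \<theta>0 \<theta>2 by (simp add: field_simps)
      finally show ?thesis .
    qed
    ultimately have "(\<Prod>i\<le>n. real (card {- b i..b i})) * real (card {0..\<lfloor>real M / \<theta>\<rfloor>})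
        \<le> (\<Prod>i\<le>n. K * 4 ^ i) * ((real M + 2) / \<theta>)"
      by (intro mult_mono) (auto intro!: prod_nonneg simp: K_def)
    then show ?thesis
      by (simp only: I_def card_cartesian_product card_PiE[OF finite_atMost] of_nat_mult of_nat_prod)
  qed
  have "real (card (F ` escape_core M)) \<le> (\<Prod>i\<le>n. K * 4 ^ i) * ((real M + 2) / \<theta>)"
    using card_mono[OF finI FI] cardI by linarith
  moreover have "dist z w \<le> 3 * \<theta>" if zw: "z \<in> escape_core M" "w \<in> escape_core M" "F z = F w" for z w
  proof -
    have Re: "\<bar>Re z - Re w\<bar> \<le> \<theta>"
      using zw(3) \<theta>0 by (intro floor_eq_imp_close) (auto simp: F_def)
    have same: "cell z i = cell w i" if "i \<le> n" for i
    proof -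
      have "restrict (cell z) {..n} i = restrict (cell w) {..n} i" using zw(3) by (simp add: F_def)
      then show ?thesis using that by simp
    qed
    have "\<bar>Im ((phi ^^ 0) z) - Im ((phi ^^ 0) w)\<bar>
       \<le> 2 * (\<Prod>i=0..<n. thin i) + 1/2 * \<bar>Re ((phi ^^ 0) z) - Re ((phi ^^ 0) w)\<bar>"
    proof (rule cylinder_thickness[OF zw(1,2), where s = "cell z"])
      show "\<bar>Im ((phi ^^ i) z) - 2 * of_int (cell z i)\<bar> \<le> 1" for i
        unfolding cell_def by (rule floor_half_cell)
      show "\<bar>Im ((phi ^^ i) w) - 2 * of_int (cell z i)\<bar> \<le> 1" if "i \<le> n" for i
        unfolding same[OF that] unfolding cell_def by (rule floor_half_cell)
    qed simp
    then have "\<bar>Im z - Im w\<bar> \<le> \<theta> + 1/2 * \<bar>Re z - Re w\<bar>"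
      by (simp add: \<theta>_def atLeast0LessThan)
    then have "\<bar>Re z - Re w\<bar> + \<bar>Im z - Im w\<bar> \<le> 3 * \<theta>" using Re \<theta>0 by argo
    then have "taxi (z - w) \<le> 3 * \<theta>" by (simp add: taxi_def)
    then show ?thesis using norm_le_taxi[of "z - w"] by (simp add: dist_norm)
  qed
  ultimately have "\<exists>U. escape_core M \<subseteq> (\<Union>i. U i) \<and> (\<forall>i. bounded (U i)) \<and> (\<Sum>i. diam_power d (U i))
      \<le> ennreal ((\<Prod>i\<le>n. K * 4 ^ i) * ((real M + 2) / \<theta>) * (3 * \<theta>) powr d)"
    using d \<theta>0 finite_subset[OF FI finI] by (intro cover_by_classes[of F]) auto
  moreover have "(\<Prod>i\<le>n. K * 4 ^ i) * ((real M + 2) / \<theta>) * (3 * \<theta>) powr d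
      = C * (\<Prod>i<n. K * 4 ^ Suc i * thin i powr (d - 1))"
  proof -
    have "(\<Prod>i<n. thin i) powr (d - 1) = (\<Prod>i<n. thin i powr (d - 1))"
      using thin_pos by (intro prod_powr_distrib)
    then have 1: "\<theta> powr (d - 1) = 2 powr (d - 1) * (\<Prod>i<n. thin i powr (d - 1))"
      using thin_pos by (simp add: \<theta>_def powr_mult prod_nonneg less_imp_le)
    have 2: "(\<Prod>i\<le>n. K * 4 ^ i) = K * (\<Prod>i<n. K * 4 ^ Suc i)"
      using prod.lessThan_Suc_shift[of "\<lambda>i. K * 4 ^ i" n] by (simp add: lessThan_Suc_atMost)
    have 3: "(3 * \<theta>) powr d / \<theta> = 3 powr d * \<theta> powr (d - 1)"
      using \<theta>0 by (simp add: powr_mult powr_diff)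
    define P where "P = (\<Prod>i<n. K * 4 ^ Suc i)"
    define Q where "Q = (\<Prod>i<n. thin i powr (d - 1))"
    have "(\<Prod>i\<le>n. K * 4 ^ i) * ((real M + 2) / \<theta>) * (3 * \<theta>) powr d
        = (K * P) * (real M + 2) * ((3 * \<theta>) powr d / \<theta>)" unfolding 2 P_def by simp
    also have "\<dots> = (K * P) * (real M + 2) * (3 powr d * (2 powr (d - 1) * Q))"
      unfolding 3 1 Q_def ..
    also have "\<dots> = C * (P * Q)" by (simp add: C_def)
    also have "P * Q = (\<Prod>i<n. K * 4 ^ Suc i * thin i powr (d - 1))"
      unfolding P_def Q_def by (rule prod.distrib[symmetric])
    finally show ?thesis .
  qed
  ultimately show "\<exists>U. escape_core M \<subseteq> (\<Union>i. U i) \<and> (\<forall>i. bounded (U i)) \<and> (\<Sum>i. diam_power d (U i)) \<le> ennreal \<epsilon>"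
    using n by (metis ennreal_leI less_imp_le order_trans)
qed

text \<open>
  The preimage is a countable union of Lipschitz images under the inverse branches.
\<close>

lemma hausdorff_null_phi_preimage:
  assumes "hausdorff_null d A" "0 < d" "\<And>z. z \<in> A \<Longrightarrow> 0 \<le> Re z"
  shows "hausdorff_null d {z. 0 \<le> Re z \<and> phi z \<in> A}"
proof -
  have "hausdorff_null d (psi j ` A)" for j
  proof (rule hausdorff_null_lipschitz_image[OF assms(1,2)])
    fix u v assume "u \<in> A" "v \<in> A"
    then have "taxi (psi j u - psi j v) \<le> 3/4 * taxi (u - v)"
      using assms(3) by (intro psi_contraction) auto
    then show "dist (psi j u) (psi j v) \<le> 2 * dist u v"
      using norm_le_taxi[of "psi j u - psi j v"] taxi_le_norm[of "u - v"] norm_ge_zero[of "u - v"]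
      unfolding dist_norm by linarith
  qed simp
  then have "hausdorff_null d (\<Union>j. psi j ` A)" by (intro hausdorff_null_UN) auto
  moreover have "{z. 0 \<le> Re z \<and> phi z \<in> A} \<subseteq> (\<Union>j. psi j ` A)"
  proof safe
    fix z assume z: "0 \<le> Re z" "phi z \<in> A"
    obtain j :: int where "\<bar>Im z - 2 * of_int j\<bar> \<le> 1" using nearest_even by blast
    then have "z = psi j (phi z)" using psi_phi z by simp
    then show "z \<in> (\<Union>j. psi j ` A)" using z by blast
  qed
  ultimately show ?thesis by (rule hausdorff_null_mono)
qed

lemma hausdorff_null_funpow_preimage:
  assumes "hausdorff_null d A" "0 < d" "\<And>z. z \<in> A \<Longrightarrow> 0 \<le> Re z"
  shows "hausdorff_null d {z. 0 \<le> Re z \<and> (phi ^^ N) z \<in> A}"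
proof (induction N)
  case 0
  show ?case using assms(1) by (rule hausdorff_null_mono) auto
next
  case (Suc N)
  have "hausdorff_null d {z. 0 \<le> Re z \<and> phi z \<in> {z. 0 \<le> Re z \<and> (phi ^^ N) z \<in> A}}"
    by (rule hausdorff_null_phi_preimage[OF Suc.IH assms(2)]) auto
  then show ?case
    by (rule hausdorff_null_mono) (auto simp: funpow_swap1 Re_phi_nonneg)
qed

text \<open>
  Since \<open>x\<^sub>n / 4\<^sup>n\<close> converges to a positive limit, \<open>overhang y\<^bsub>n+1\<^esub> = 4 x\<^sub>n - x\<^bsub>n+1\<^esub>\<close> is small compared to
  \<open>x\<^sub>n\<close>. This is the reason why curves and endpoints behave so differently: along an
  orbit of potential 0 the imaginary part may be dominant infinitely often.
\<close>

lemma ray_enters_escape_core: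
  assumes z: "0 \<le> Re z" and p: "0 < potential z"
  shows "\<exists>N M. (phi ^^ N) z \<in> escape_core M"
proof -
  define p where "p = potential z"
  have p0: "0 < p" using p by (simp add: p_def)
  \<comment> \<open>With \<open>9/8\<close>, the overhang at time \<open>n + 1\<close> is at most \<open>(4 * 9/8 - 4) * p * 4\<^sup>n = p * 4\<^sup>n / 2\<close>.\<close>
  have "\<forall>\<^sub>F n in sequentially. Re ((phi ^^ n) z) / 4 ^ n < 9/8 * p"
    using p0 potential_LIMSEQ[OF z] by (intro order_tendstoD) (auto simp: p_def)
  moreover have "filterlim (\<lambda>n. p * 4 ^ n) at_top sequentially"
    using p0 by (intro filterlim_tendsto_pos_mult_at_top[OF tendsto_const] filterlim_power_of_4)
  then have "\<forall>\<^sub>F n in sequentially. 3 \<le> p * 4 ^ n" by (simp add: filterlim_at_top)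
  ultimately have "\<forall>\<^sub>F n in sequentially. Re ((phi ^^ n) z) / 4 ^ n < 9/8 * p \<and> 3 \<le> p * 4 ^ n"
    by (rule eventually_conj)
  then obtain N where N: "\<And>n. n \<ge> N \<Longrightarrow> Re ((phi ^^ n) z) / 4 ^ n < 9/8 * p \<and> 3 \<le> p * 4 ^ n"
    by (auto simp: eventually_sequentially)
  define u where "u = (phi ^^ N) z"
  have u: "(phi ^^ n) u = (phi ^^ (n + N)) z" for n by (simp add: u_def funpow_add)
  have grow: "4 ^ n \<le> Re ((phi ^^ n) u)" for n
  proof -
    have "4 ^ n * 1 \<le> 4 ^ n * (p * 4 ^ N)" using N[of N] by (intro mult_left_mono) auto
    also have "\<dots> = 4 ^ (n + N) * p" by (simp add: power_add)
    also have "\<dots> \<le> Re ((phi ^^ n) u)" unfolding u p_def by (rule potential_le[OF z])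
    finally show ?thesis by simp
  qed
  have middle: "\<bar>Im ((phi ^^ Suc n) u)\<bar> \<le> 4 + 2 * Re ((phi ^^ n) u)" for n
  proof -
    define k where "k = n + N"
    have k: "Re ((phi ^^ k) z) \<le> 9/8 * (p * 4 ^ k)" "3 \<le> p * 4 ^ k"
      using N[of k] by (auto simp: k_def field_simps)
    have "4 ^ Suc k * p \<le> Re ((phi ^^ Suc k) z)" "4 ^ k * p \<le> Re ((phi ^^ k) z)"
      unfolding p_def by (intro potential_le[OF z])+
    then have "overhang (Im ((phi ^^ Suc k) z)) \<le> 1/2 * (p * 4 ^ k)" "p * 4 ^ k \<le> Re ((phi ^^ k) z)"
      using k(1) by (auto simp: Re_phi algebra_simps)
    then have "\<bar>Im ((phi ^^ Suc k) z)\<bar> \<le> 4 + 2 * Re ((phi ^^ k) z)"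
      using k(2) abs_le_overhang[of "Im ((phi ^^ Suc k) z)"] by linarith
    then show ?thesis using u[of n] u[of "Suc n"] by (simp only: k_def add_Suc)
  qed
  obtain M :: nat where "\<bar>Re u\<bar> + \<bar>Im u\<bar> \<le> real M" using real_arch_simple by blast
  then have "u \<in> escape_core M" using grow middle unfolding escape_core_def by auto
  then show ?thesis unfolding u_def by blast
qed

lemma hausdorff_null_ray_set:
  assumes "1 < d" shows "hausdorff_null d ray_set"
proof -
  define H where "H = {z. 0 \<le> Re z \<and> 0 < potential z}"
  have "hausdorff_null d (\<Union>N. \<Union>M. {z. 0 \<le> Re z \<and> (phi ^^ N) z \<in> escape_core M})"
    using assms by (intro hausdorff_null_UN_nat hausdorff_null_funpow_preimage hausdorff_null_escape_core)
      (auto intro: escape_core_nonneg)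
  then have H: "hausdorff_null d H"
    by (rule hausdorff_null_mono) (use ray_enters_escape_core in \<open>auto simp: H_def\<close>)
  define mirror where "mirror z = Complex (- Re z) (Im z)" for z
  have "dist (mirror u) (mirror v) = dist u v" for u v
    by (simp add: dist_norm cmod_def mirror_def power2_commute)
  then have "hausdorff_null d (mirror ` H)"
    using assms by (intro hausdorff_null_lipschitz_image[OF H, of 1]) auto
  with H have "hausdorff_null d (\<Union>A\<in>{H, mirror ` H}. A)"
    by (intro hausdorff_null_UN) auto
  moreover have "ray_set \<subseteq> (\<Union>A\<in>{H, mirror ` H}. A)"
  proof
    fix z assume z: "z \<in> ray_set"
    then have "fold_plane z \<in> H" by (simp add: ray_set_def H_def)
    moreover have "z = fold_plane z \<or> z = mirror (fold_plane z)"
      by (auto simp: fold_plane_def mirror_def complex_eq_iff)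
    ultimately show "z \<in> (\<Union>A\<in>{H, mirror ` H}. A)" by auto
  qed
  ultimately show ?thesis by (rule hausdorff_null_mono)
qed

lemma positive_axis_in_ray_set:
  assumes "0 < x" shows "Complex x 0 \<in> ray_set"
proof -
  have phi: "phi (Complex y 0) = Complex (4 * y) 0" for y
    by (simp add: phi_def Let_def triangle_wave_def unsqueeze_def overhang_def)
  have "(phi ^^ n) (Complex x 0) = Complex (4 ^ n * x) 0" for n
    by (induction n) (auto simp: phi)
  then have "(\<lambda>n. Re ((phi ^^ n) (Complex x 0)) / 4 ^ n) \<longlonglongrightarrow> x" by simp
  then have "potential (Complex x 0) = x"
    using potential_LIMSEQ[of "Complex x 0"] assms by (metis LIMSEQ_unique complex.sel(1) less_imp_le)
  then show ?thesis using assms by (simp add: ray_set_def fold_plane_def)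
qed

text \<open>
  The positive real axis is one of the curves: it is invariant, and \<open>phi\<close> acts on it as
  multiplication by 4.
\<close>

lemma not_hausdorff_null_1_ray_set: "\<not> hausdorff_null 1 ray_set"
proof
  assume "hausdorff_null 1 ray_set"
  then have "hausdorff_null (DIM(real)) (Re ` ray_set)"
    using abs_Re_le_cmod by (auto intro!: hausdorff_null_lipschitz_image[of 1 _ 1]
        simp: dist_norm simp flip: minus_complex.sel)
  then have "negligible (Re ` ray_set)" by (rule hausdorff_null_imp_negligible)
  moreover have "cbox 1 2 \<subseteq> Re ` ray_set"
  proof
    fix x :: real assume "x \<in> cbox 1 2"
    then have "Complex x 0 \<in> ray_set" by (intro positive_axis_in_ray_set) auto
    then show "x \<in> Re ` ray_set" by (metis complex.sel(1) imageI)
  qed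
  ultimately have "negligible (cbox 1 (2::real))" by (rule negligible_subset)
  moreover have "box 1 (2::real) \<noteq> {}" by simp
  ultimately show False unfolding negligible_interval by blast
qed

lemma negligible_ray_set: "negligible ray_set"
proof (rule hausdorff_null_imp_negligible)
  show "hausdorff_null (DIM(complex)) ray_set" by (simp add: hausdorff_null_ray_set)
qed

lemma not_hausdorff_null_2_endpoints: "\<not> hausdorff_null 2 (- ray_set)"
proof
  assume "hausdorff_null 2 (- ray_set)"
  then have "negligible (- ray_set)"
    by (intro hausdorff_null_imp_negligible) simp
  then have "negligible (- ray_set \<union> ray_set)" using negligible_ray_set by (rule negligible_Un)
  then show False by (simp add: Un_commute)
qed

theorem theorem1:
  "\<exists>E R :: complex set.
     E \<inter> R = {} \<and>
     (\<forall>C \<in> path_components_of (top_of_set R).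
        \<exists>\<gamma>. \<exists>e \<in> E. injective_curve_to_infinity \<gamma> e \<and> C = \<gamma> ` {0<..}) \<and>
     (\<forall>e \<in> E. \<exists>C \<in> path_components_of (top_of_set R).
        \<exists>\<gamma>. injective_curve_to_infinity \<gamma> e \<and> C = \<gamma> ` {0<..}) \<and>
     R = \<Union> {\<gamma> ` {0<..} | \<gamma>. \<exists>e \<in> E. injective_curve_to_infinity \<gamma> e \<and>
               \<gamma> ` {0<..} \<in> path_components_of (top_of_set R)} \<and>
     hausdorff_dim R = 1 \<and>
     hausdorff_dim E = 2 \<and>
     - E \<in> null_sets lebesgue \<and>
     E \<union> R = UNIV"
proof (rule exI[of _ "- ray_set"], rule exI[of _ ray_set], intro conjI)
  show "hausdorff_dim ray_set = 1"
    using hausdorff_dim_eqI[OF _ not_hausdorff_null_1_ray_set hausdorff_null_ray_set] by simp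
  show "hausdorff_dim (- ray_set) = 2"
    using hausdorff_dim_eqI[OF _ not_hausdorff_null_2_endpoints hausdorff_null_complex] by simp
  show "- (- ray_set) \<in> null_sets lebesgue"
    using negligible_ray_set by (simp add: negligible_iff_null_sets)
qed (rule ray_set_structure | simp)+

end
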